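(* Let $\beta\in(0,1)$, and assume that either $\alpha\in(0,1)$, or $\alpha\in(1,2)$ with $\mu=\mathbb E[\xi_1]=0$. For $t\in[0,+\infty)$ and $n\in\mathbb Z^+$ define $$\hat Y^{(n)}(t):=\frac{Y_{\lfloor nt\rfloor}}{n^{1/(\alpha\beta)}}.$$ Then the finite-dimensional distributions of $\hat Y^{(n)}$ converge to those of $Z^{(\beta)}\circ W^{(\alpha)}$; that is, for every $m\in\mathbb Z^+$ and all $t_1,\dots,t_m\in[0,+\infty)$, $$\big(\hat Y^{(n)}(t_1),\dots,\hat Y^{(n)}(t_m)\big)\xrightarrow{\ d\ }\big(Z^{(\beta)}(W^{(\alpha)}(t_1)),\dots,Z^{(\beta)}(W^{(\alpha)}(t_m))\big)\qquad\text{as } n\to\infty.$$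
   Context: Medium: $\zeta=(\zeta_i)_{i\in\mathbb Z}$ are i.i.d. positive random variables in the normal domain of attraction of a $\beta$-stable law, which for $\beta\in(0,1)$ means $n^{-1/\beta}\sum_{i=1}^n\zeta_i\xrightarrow{d}Z^{(\beta)}_1$, where $Z^{(\beta)}_1$ is a (non-degenerate) stable variable of index $\beta$ (with skewness parameter $1$). Put $\omega_0=0$, $\omega_k=\sum_{i=1}^k\zeta_i$ for $k>0$, $\omega_k=-\sum_{i=k}^{-1}\zeta_i$ for $k<0$. Underlying random walk: $S_0=0$, $S_n=\sum_{i=1}^n\xi_i$, where $(\xi_i)_{i\ge1}$ are i.i.d. $\mathbb Z$-valued random variables, independent of $\zeta$, in the normal domain of attraction of an $\alpha$-stable law; in the cases considered here ($\alpha\in(0,1)$, or $\alpha\in(1,2)$ and $\mu=0$) this means $n^{-1/\alpha}\sum_{i=1}^n\xi_i\xrightarrow{d}W^{(\alpha)}_1$ with $W^{(\alpha)}_1$ a (non-degenerate) stable variable of index $\alpha$. Random walk on the random medium: $Y_n:=\omega_{S_n}$, $n\in\mathbb N$. All laws are with respect to the probability $\mathbb P$ governing both $\zeta$ and $(\xi_i)$ (annealed law). Limit processes: $(Z^{(\beta)}_\pm(s))_{s\ge0}$ are two i.i.d. càdlàg Lévy $\beta$-stable processes with $Z^{(\beta)}_\pm(0)=0$ and $Z^{(\beta)}_\pm(1)$ distributed like $Z^{(\beta)}_1$; $Z^{(\beta)}(s):=Z^{(\beta)}_+(s)$ for $s\ge0$ and $Z^{(\beta)}(s):=-Z^{(\beta)}_-(-s)$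 for $s<0$. $(W^{(\alpha)}(t))_{t\ge0}$ is a càdlàg Lévy $\alpha$-stable process with $W^{(\alpha)}(0)=0$ and $W^{(\alpha)}(1)$ distributed like $W^{(\alpha)}_1$, independent of $Z^{(\beta)}$. *)

theory Defs
  imports "HOL-Probability.Probability"
begin

section \<open>Stable laws\<close>

text \<open>
  The characteristic function of the stable law \<open>S\<^sub>\<alpha>(\<sigma>, b, \<mu>)\<close> of index \<open>\<alpha>\<close>, scale \<open>\<sigma>\<close>,
  skewness \<open>b\<close> and location \<open>\<mu>\<close>, in the standard (Samorodnitsky--Taqqu) parametrisation.  For
  \<open>\<alpha> < 1\<close>, \<open>b = 1\<close> and \<open>\<mu> = 0\<close> the law is supported on the positive half-line.
\<close>

definition stable_char :: "real \<Rightarrow> real \<Rightarrow> real \<Rightarrow> real \<Rightarrow> real \<Rightarrow> complex" where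
  "stable_char \<alpha> \<sigma> b \<mu> \<theta> =
     (let \<Phi> = (if \<alpha> = 1 then - (2 / pi) * ln \<bar>\<theta>\<bar> else tan (pi * \<alpha> / 2))
      in exp (\<i> * complex_of_real (\<mu> * \<theta>)
              - complex_of_real ((\<sigma> * \<bar>\<theta>\<bar>) powr \<alpha>)
                * (1 - \<i> * complex_of_real (b * sgn \<theta> * \<Phi>))))"

text \<open>
  The strict inequality \<open>\<sigma> > 0\<close> excludes the degenerate laws.
\<close>

definition stable_law :: "real \<Rightarrow> real \<Rightarrow> real measure \<Rightarrow> bool" where
  "stable_law \<alpha> b P \<longleftrightarrow>
     0 < \<alpha> \<and> \<alpha> \<le> 2 \<and> - 1 \<le> b \<and> b \<le> 1 \<and> real_distribution P \<and>
     (\<exists>\<sigma>>0. \<exists>\<mu>. \<forall>\<theta>. char P \<theta> = stable_char \<alpha> \<sigma> b \<mu> \<theta>)"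

section \<open>I.i.d. families and processes\<close>

definition iid :: "'a measure \<Rightarrow> 'b measure \<Rightarrow> 'i set \<Rightarrow> ('i \<Rightarrow> 'a \<Rightarrow> 'b) \<Rightarrow> bool" where
  "iid M N I X \<longleftrightarrow>
     prob_space.indep_vars M (\<lambda>_. N) X I \<and>
     (\<forall>i\<in>I. \<forall>j\<in>I. distr M N (X i) = distr M N (X j))"

text \<open>
  A process \<open>X\<close> indexed by \<open>I\<close>, as a single random element of the product space \<open>\<Pi>\<^sub>M i\<in>I. N\<close>.
\<close>

definition sample_path :: "'i set \<Rightarrow> ('i \<Rightarrow> 'a \<Rightarrow> 'b) \<Rightarrow> 'a \<Rightarrow> 'i \<Rightarrow> 'b" where
  "sample_path I X w = (\<lambda>i\<in>I. X i w)"

text \<open>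
  Independence of the \<open>\<sigma>\<close>-algebras generated by two processes.  The library's \<open>indep_var\<close>
  does not apply directly, since it requires both random elements to have the same type.
\<close>

definition indep_processes ::
    "'a measure \<Rightarrow> 'b measure \<Rightarrow> 'i set \<Rightarrow> ('i \<Rightarrow> 'a \<Rightarrow> 'b)
      \<Rightarrow> 'c measure \<Rightarrow> 'j set \<Rightarrow> ('j \<Rightarrow> 'a \<Rightarrow> 'c) \<Rightarrow> bool" where
  "indep_processes M N1 I X N2 J Y \<longleftrightarrow>
     prob_space.indep_set M
       (sets (vimage_algebra (space M) (sample_path I X) (\<Pi>\<^sub>M i\<in>I. N1)))
       (sets (vimage_algebra (space M) (sample_path J Y) (\<Pi>\<^sub>M j\<in>J. N2)))"

text \<open>
  Normal domain of attraction, in the form without centring: this is the appropriate one for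
  \<open>\<alpha> \<in> (0,1)\<close>, and for \<open>\<alpha> \<in> (1,2)\<close> when the summands have mean zero.
\<close>

definition normally_attracted ::
    "'a measure \<Rightarrow> (nat \<Rightarrow> 'a \<Rightarrow> real) \<Rightarrow> real \<Rightarrow> real measure \<Rightarrow> bool" where
  "normally_attracted M X \<alpha> P \<longleftrightarrow>
     weak_conv_m (\<lambda>n. distr M borel (\<lambda>w. (\<Sum>i=1..n. X i w) / real n powr (1 / \<alpha>))) P"

section \<open>Levy processes\<close>

definition cadlag :: "(real \<Rightarrow> real) \<Rightarrow> bool" where
  "cadlag f \<longleftrightarrow>
     (\<forall>s\<ge>0. (f \<longlongrightarrow> f s) (at_right s)) \<and> (\<forall>s>0. \<exists>l. (f \<longlongrightarrow> l) (at_left s))"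

text \<open>
  Time is \<open>[0,\<infinity>)\<close>; the values at negative times are irrelevant.
\<close>

definition levy_process :: "'a measure \<Rightarrow> (real \<Rightarrow> 'a \<Rightarrow> real) \<Rightarrow> bool" where
  "levy_process N X \<longleftrightarrow>
     (\<forall>t\<ge>0. X t \<in> borel_measurable N) \<and>
     (\<forall>w\<in>space N. X 0 w = 0) \<and>
     (\<forall>w\<in>space N. cadlag (\<lambda>t. X t w)) \<and>
     (\<forall>(k::nat) t. 0 \<le> t 0 \<longrightarrow> (\<forall>i<k. t i < t (Suc i)) \<longrightarrow>
        prob_space.indep_vars N (\<lambda>_. borel) (\<lambda>i w. X (t (Suc i)) w - X (t i) w) {..<k}) \<and>
     (\<forall>s\<ge>0. \<forall>t\<ge>0. distr N borel (\<lambda>w. X (s + t) w - X s w) = distr N borel (X t))"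

definition two_sided :: "(real \<Rightarrow> 'a \<Rightarrow> real) \<Rightarrow> (real \<Rightarrow> 'a \<Rightarrow> real) \<Rightarrow> real \<Rightarrow> 'a \<Rightarrow> real" where
  "two_sided Zp Zm s w = (if 0 \<le> s then Zp s w else - Zm (- s) w)"

section \<open>The random walk on the random medium\<close>

text \<open>The variable \<open>\<zeta> 0\<close> does not contribute to the medium.\<close>

definition medium :: "(int \<Rightarrow> 'a \<Rightarrow> real) \<Rightarrow> int \<Rightarrow> 'a \<Rightarrow> real" where
  "medium \<zeta> k w = (if 0 \<le> k then (\<Sum>i=1..k. \<zeta> i w) else - (\<Sum>i=k..-1. \<zeta> i w))"

definition walk :: "(nat \<Rightarrow> 'a \<Rightarrow> int) \<Rightarrow> nat \<Rightarrow> 'a \<Rightarrow> int" where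
  "walk \<xi> n w = (\<Sum>i=1..n. \<xi> i w)"

definition walk_on_medium ::
    "(int \<Rightarrow> 'a \<Rightarrow> real) \<Rightarrow> (nat \<Rightarrow> 'a \<Rightarrow> int) \<Rightarrow> nat \<Rightarrow> 'a \<Rightarrow> real" where
  "walk_on_medium \<zeta> \<xi> n w = medium \<zeta> (walk \<xi> n w) w"

definition rescaled_walk ::
    "real \<Rightarrow> real \<Rightarrow> (int \<Rightarrow> 'a \<Rightarrow> real) \<Rightarrow> (nat \<Rightarrow> 'a \<Rightarrow> int) \<Rightarrow> nat \<Rightarrow> real \<Rightarrow> 'a \<Rightarrow> real" where
  "rescaled_walk \<alpha> \<beta> \<zeta> \<xi> n t w =
     walk_on_medium \<zeta> \<xi> (nat \<lfloor>real n * t\<rfloor>) w / real n powr (1 / (\<alpha> * \<beta>))"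

section \<open>Convergence in distribution\<close>

text \<open>
  The library's \<open>weak_conv_m\<close> covers only laws on the real line; for random elements of a
  general topological space (here \<open>real ^ 'm\<close>) we test against bounded continuous functions.  The
  two notions agree for real random variables, see \<open>converges_in_distr_real_iff\<close> below.
\<close>

definition converges_in_distr ::
    "'a measure \<Rightarrow> (nat \<Rightarrow> 'a \<Rightarrow> 'c::topological_space) \<Rightarrow> 'b measure \<Rightarrow> ('b \<Rightarrow> 'c) \<Rightarrow> bool" where
  "converges_in_distr M X N Y \<longleftrightarrow>
     (\<forall>n. X n \<in> borel_measurable M) \<and> Y \<in> borel_measurable N \<and>
     (\<forall>f::'c \<Rightarrow> real. continuous_on UNIV f \<longrightarrow> bounded (range f) \<longrightarrow>
        (\<lambda>n. \<integral>w. f (X n w) \<partial>M) \<longlonglongrightarrow> (\<integral>w. f (Y w) \<partial>N))"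

lemma converges_in_distr_real_iff:
  fixes X :: "nat \<Rightarrow> 'a \<Rightarrow> real" and Y :: "'b \<Rightarrow> real"
  assumes M: "prob_space M" and N: "prob_space N"
    and X [measurable]: "\<And>n. X n \<in> borel_measurable M"
    and Y [measurable]: "Y \<in> borel_measurable N"
  shows "converges_in_distr M X N Y \<longleftrightarrow>
    weak_conv_m (\<lambda>n. distr M borel (X n)) (distr N borel Y)"
proof -
  have rX: "real_distribution (distr M borel (X n))" for n
    using prob_space.prob_space_distr[OF M X]
    by (simp add: real_distribution_def real_distribution_axioms_def)
  have rY: "real_distribution (distr N borel Y)"
    using prob_space.prob_space_distr[OF N Y]
    by (simp add: real_distribution_def real_distribution_axioms_def)
  have [measurable]: "f \<in> borel_measurable borel" if "continuous_on UNIV f" for f :: "real \<Rightarrow> real"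
    using that by (rule borel_measurable_continuous_onI)
  have iX: "integral\<^sup>L (distr M borel (X n)) f = (\<integral>w. f (X n w) \<partial>M)"
    if "continuous_on UNIV f" for f :: "real \<Rightarrow> real" and n
    using that by (intro integral_distr) measurable
  have iY: "integral\<^sup>L (distr N borel Y) f = (\<integral>w. f (Y w) \<partial>N)"
    if "continuous_on UNIV f" for f :: "real \<Rightarrow> real"
    using that by (intro integral_distr) measurable
  show ?thesis
  proof
    assume conv: "converges_in_distr M X N Y"
    show "weak_conv_m (\<lambda>n. distr M borel (X n)) (distr N borel Y)"
    proof (rule integral_bdd_continuous_conv_imp_weak_conv[OF rX rY])
      fix f :: "real \<Rightarrow> real"
      assume c: "\<And>x. isCont f x" and b: "\<And>x. \<bar>f x\<bar> \<le> 1"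
      have cf: "continuous_on UNIV f" using c by (simp add: continuous_at_imp_continuous_on)
      have bf: "bounded (range f)" using b by (auto simp: bounded_iff)
      show "(\<lambda>n. integral\<^sup>L (distr M borel (X n)) f) \<longlonglongrightarrow> integral\<^sup>L (distr N borel Y) f"
        using conv cf bf by (simp add: converges_in_distr_def iX iY)
    qed
  next
    assume conv: "weak_conv_m (\<lambda>n. distr M borel (X n)) (distr N borel Y)"
    have "(\<lambda>n. \<integral>w. f (X n w) \<partial>M) \<longlonglongrightarrow> (\<integral>w. f (Y w) \<partial>N)"
      if cf: "continuous_on UNIV f" and bf: "bounded (range f)" for f :: "real \<Rightarrow> real"
    proof -
      obtain B where B: "\<And>x. norm (f x) \<le> B" using bf by (auto simp: bounded_iff)
      have c: "\<And>x. isCont f x" using cf by (simp add: continuous_on_eq_continuous_at)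
      show ?thesis
        using weak_conv_imp_integral_bdd_continuous_conv[OF rX rY conv c B]
        by (simp add: iX[OF cf] iY[OF cf])
    qed
    then show "converges_in_distr M X N Y"
      by (simp add: converges_in_distr_def X Y)
  qed
qed

end

(*
  Writing c = n^(1/alpha), the walk position S(floor(n t)) is of order c and the medium at distance c
  is of order c^(1/beta).  Skorohod's representation of the partial sums, applied on a product space to
  the independent increments between the sorted times, gives copies of (S(floor(n t_j)) / c)_j that
  converge pointwise to a copy of (W(t_j))_j.  The limit of the increments over a time s is
  s^(1/alpha) W(1), and this is the law of W(s) because both families of laws are convolution
  semigroups that agree at time 1, where the characteristic function has no zero.

  The same coupling on both half-lines shows that E f(omega_{z_j} / c^(1/beta)) converges to
  E f(Z(x_j)) along the canonical integers z_j with z_j / c -> x_j; a Lipschitz f and stationarity of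
  the increments of the medium extend this to all integers z_j(n) with z_j(n) / c -> x_j.  By
  independence the law of Y is obtained by integrating these expectations over the walk, so the
  two convergences combine by dominated convergence.
*)

theory Submission
  imports Defs
begin

text \<open>The obstacle is that the outer path \<open>Z\<close> jumps. Composition of paths is not
  continuous there, so the limits of the walk and of the medium cannot simply be composed by a
  continuous mapping argument. Averaging over the medium first removes the problem: a Levy path
  almost surely has no jump at a prescribed point, so the averages G_n over the medium converge
  continuously, G_n(u_n) -> F(u) whenever u_n -> u. Convergence at each fixed u would not be enough,
  because the coupled walk positions move with n; hence the passage from canonical integers to
  arbitrary ones. The error of that passage is measured by a truncated modulus of continuity, since
  increments of the medium need not have a finite mean. Everything is done with vectors of values at
  finitely many times, so no topology on path space enters. The semigroup property of the limit law
  is read off the partial sums themselves and not off the formula for the stable characteristic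
  function.\<close>

section \<open>Laws of i.i.d. sums, and Lipschitz test functions for weak convergence\<close>

lemma distr_iid_sum_cong:
  fixes X :: "'i \<Rightarrow> 'a \<Rightarrow> real" and Y :: "'j \<Rightarrow> 'a \<Rightarrow> real"
  assumes "prob_space M"
    and X: "prob_space.indep_vars M (\<lambda>_. borel) X D" "\<And>i. i \<in> D \<Longrightarrow> distr M borel (X i) = Q"
    and Y: "prob_space.indep_vars M (\<lambda>_. borel) Y E" "\<And>i. i \<in> E \<Longrightarrow> distr M borel (Y i) = Q"
    and card: "card D = card E"
  shows "distr M borel (\<lambda>w. \<Sum>i\<in>D. X i w) = distr M borel (\<lambda>w. \<Sum>i\<in>E. Y i w)"
proof -
  interpret prob_space M by fact
  have [measurable]: "random_variable borel (X i)" if "i \<in> D" for i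
    using X(1) that by (auto simp: indep_vars_def)
  have [measurable]: "random_variable borel (Y i)" if "i \<in> E" for i
    using Y(1) that by (auto simp: indep_vars_def)
  show ?thesis
  proof (rule Levy_uniqueness)
    show "char (distr M borel (\<lambda>w. \<Sum>i\<in>D. X i w)) = char (distr M borel (\<lambda>w. \<Sum>i\<in>E. Y i w))"
      \<comment> \<open>By independence both sides are the same power of \<open>char Q\<close>,
        whatever the index types are.\<close>
      by (rule ext) (simp add: char_distr_sum X Y card)
  qed (intro real_distribution_distr; measurable)+
qed

lemma distr_scale_cong:
  fixes U :: "'a \<Rightarrow> real" and V :: "'b \<Rightarrow> real"
  assumes [measurable]: "U \<in> borel_measurable M" "V \<in> borel_measurable N"
    and eq: "distr M borel U = distr N borel V"
  shows "distr M borel (\<lambda>w. c * U w) = distr N borel (\<lambda>w. c * V w)"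
proof -
  have "distr M borel (\<lambda>w. c * U w) = distr (distr M borel U) borel (\<lambda>x. c * x)"
    by (simp add: distr_distr comp_def)
  also have "\<dots> = distr N borel (\<lambda>w. c * V w)"
    unfolding eq by (simp add: distr_distr comp_def)
  finally show ?thesis .
qed

text \<open>A bounded continuous \<open>f\<close> is the increasing limit of the Lipschitz functions
  \<open>x \<mapsto> inf\<^sub>y (f y + k * dist x y)\<close>.\<close>

lemma lipschitz_approx_below:
  fixes f :: "'c::metric_space \<Rightarrow> real"
  assumes cont: "continuous_on UNIV f" and B: "\<And>x. \<bar>f x\<bar> \<le> B"
  obtains g :: "nat \<Rightarrow> 'c \<Rightarrow> real"
  where "\<And>k. (real k)-lipschitz_on UNIV (g k)" "\<And>k x. \<bar>g k x\<bar> \<le> B" "\<And>k x. g k x \<le> f x"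
    "\<And>x. (\<lambda>k. g k x) \<longlonglongrightarrow> f x"
proof -
  define g where "g k x = (INF y. f y + real k * dist x y)" for k x
  have lower: "- B \<le> f y + real k * dist x y" for k x y
    using B[of y] mult_nonneg_nonneg[OF of_nat_0_le_iff[of k] zero_le_dist[of x y]] by linarith
  have bdd: "bdd_below (range (\<lambda>y. f y + real k * dist x y))" for k x
    using lower by (auto intro!: bdd_belowI2)
  have le: "g k x \<le> f y + real k * dist x y" for k x y
    unfolding g_def by (rule cINF_lower[OF bdd]) simp
  have gf: "g k x \<le> f x" for k x using le[of k x x] by simp
  have gB: "- B \<le> g k x" for k x
    unfolding g_def by (rule cINF_greatest) (auto intro: lower)
  have lip: "g k x \<le> g k x' + real k * dist x x'" for k x x'
  proof -
    have "g k x - real k * dist x x' \<le> g k x'"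
      unfolding g_def[of k x']
    proof (rule cINF_greatest)
      fix y
      have "real k * dist x y \<le> real k * (dist x x' + dist x' y)"
        by (intro mult_left_mono dist_triangle) simp
      then show "g k x - real k * dist x x' \<le> f y + real k * dist x' y"
        using le[of k x y] by (simp add: algebra_simps)
    qed simp
    then show ?thesis by simp
  qed
  have conv: "(\<lambda>k. g k x) \<longlonglongrightarrow> f x" for x
  proof (rule LIMSEQ_I)
    fix e :: real assume e: "0 < e"
    have "isCont f x" using cont by (simp add: continuous_on_eq_continuous_at)
    then obtain d where d: "d > 0" "\<And>y. dist y x < d \<Longrightarrow> dist (f y) (f x) < e / 2"
      using e by (metis continuous_at_eps_delta half_gt_zero)
    \<comment> \<open>From slope \<open>K\<close> on, a point at distance at least \<open>d\<close>
      pays a penalty of at least \<open>2 * B\<close>, the largest possible oscillation of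
      \<open>f\<close>, so it cannot bring the infimum below \<open>f x\<close>.\<close>
    obtain K where K: "2 * B / d < real K" using reals_Archimedean2 by blast
    have near: "f x - e / 2 \<le> g k x" if k: "K \<le> k" for k
      unfolding g_def
    proof (rule cINF_greatest)
      fix y
      show "f x - e / 2 \<le> f y + real k * dist x y"
      proof (cases "dist y x < d")
        case True
        then have "\<bar>f y - f x\<bar> < e / 2" using d(2) by (simp add: dist_real_def)
        then show ?thesis
          using mult_nonneg_nonneg[OF of_nat_0_le_iff[of k] zero_le_dist[of x y]] e by linarith
      next
        case False
        have "2 * B \<le> real K * d" using K d(1) by (simp add: field_simps)
        also have "\<dots> \<le> real k * dist x y"
          using False k d(1) by (intro mult_mono) (auto simp: dist_commute)
        finally show ?thesis using B[of x] B[of y] e by (simp add: abs_le_iff)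
      qed
    qed simp
    then have "norm (g k x - f x) < e" if "K \<le> k" for k
      using that[THEN near] gf[of k x] e by simp
    then show "\<exists>no. \<forall>n\<ge>no. norm (g n x - f x) < e" by blast
  qed
  show ?thesis
  proof (rule that[of g])
    show "(real k)-lipschitz_on UNIV (g k)" for k
    proof (rule lipschitz_onI)
      fix x x'
      show "dist (g k x) (g k x') \<le> real k * dist x x'"
        using lip[of k x x'] lip[of k x' x] by (simp add: dist_real_def abs_le_iff dist_commute)
    qed simp
    show "\<bar>g k x\<bar> \<le> B" for k x using gf[of k x] gB[of k x] B[of x] by (simp add: abs_le_iff)
  qed (use gf conv in auto)
qed

text \<open>A Lipschitz minorant whose integral against the limit law is within \<open>e\<close> can
  be kept fixed while \<open>n\<close> grows, so no uniform approximation is needed. It bounds the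
  lower limit of the integrals for each bounded continuous function; using this for \<open>f\<close>
  and for \<open>- f\<close> gives convergence.\<close>

lemma converges_in_distr_lipschitzI:
  fixes X :: "nat \<Rightarrow> 'a \<Rightarrow> 'c::metric_space"
  assumes M: "prob_space M" and N: "prob_space N"
    and X [measurable]: "\<And>n. X n \<in> borel_measurable M"
    and Y [measurable]: "Y \<in> borel_measurable N"
    and lim: "\<And>f L B. \<lbrakk>L-lipschitz_on UNIV f; \<And>x. \<bar>f x\<bar> \<le> B\<rbrakk> \<Longrightarrow>
      (\<lambda>n. \<integral>w. f (X n w) \<partial>M) \<longlonglongrightarrow> (\<integral>w. (f (Y w) :: real) \<partial>N)"
  shows "converges_in_distr M X N Y"
proof -
  interpret M: prob_space M by fact
  interpret N: prob_space N by fact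
  have low: "\<forall>\<^sub>F n in sequentially. (\<integral>w. f (Y w) \<partial>N) - e < (\<integral>w. f (X n w) \<partial>M)"
    if f: "continuous_on UNIV f" and B: "\<And>x. \<bar>f x\<bar> \<le> B" and e: "e > 0" for f :: "'c \<Rightarrow> real" and B e
  proof -
    obtain g where g: "\<And>k. (real k)-lipschitz_on UNIV (g k)" "\<And>k x. \<bar>g k x\<bar> \<le> B"
      "\<And>k x. g k x \<le> f x" "\<And>x. (\<lambda>k. g k x) \<longlonglongrightarrow> f x"
      using lipschitz_approx_below[OF f B] by metis
    have [measurable]: "f \<in> borel_measurable borel" "g k \<in> borel_measurable borel" for k
      using f lipschitz_on_continuous_on[OF g(1)] by (auto intro: borel_measurable_continuous_onI)
    have "(\<lambda>k. \<integral>w. g k (Y w) \<partial>N) \<longlonglongrightarrow> (\<integral>w. f (Y w) \<partial>N)"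
      by (rule integral_dominated_convergence[where w="\<lambda>_. B"]) (auto simp: g)
    then have "\<forall>\<^sub>F k in sequentially. (\<integral>w. f (Y w) \<partial>N) - e < (\<integral>w. g k (Y w) \<partial>N)"
      by (rule order_tendstoD) (use e in auto)
    then obtain k where k: "(\<integral>w. f (Y w) \<partial>N) - e < (\<integral>w. g k (Y w) \<partial>N)"
      by (auto simp: eventually_sequentially)
    have "\<forall>\<^sub>F n in sequentially. (\<integral>w. f (Y w) \<partial>N) - e < (\<integral>w. g k (X n w) \<partial>M)"
      by (rule order_tendstoD(1)[OF lim[OF g(1) g(2)] k])
    moreover have "(\<integral>w. g k (X n w) \<partial>M) \<le> (\<integral>w. f (X n w) \<partial>M)" for n
      by (intro integral_mono M.integrable_const_bound[where B=B]) (auto simp: g B)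
    ultimately show ?thesis by (auto elim!: eventually_mono intro: less_le_trans)
  qed
  have "(\<lambda>n. \<integral>w. f (X n w) \<partial>M) \<longlonglongrightarrow> (\<integral>w. f (Y w) \<partial>N)"
    if f: "continuous_on UNIV f" "bounded (range f)" for f :: "'c \<Rightarrow> real"
  proof -
    obtain B where B: "\<And>x. \<bar>f x\<bar> \<le> B" using f(2) by (auto simp: bounded_iff)
    have mf: "continuous_on UNIV (\<lambda>x. - f x)" using f(1) by (rule continuous_on_minus)
    show ?thesis
    proof (rule order_tendstoI)
      fix c assume "c < (\<integral>w. f (Y w) \<partial>N)"
      then show "\<forall>\<^sub>F n in sequentially. c < (\<integral>w. f (X n w) \<partial>M)"
        using low[OF f(1) B, of "(\<integral>w. f (Y w) \<partial>N) - c"] by simp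
    next
      fix c assume "(\<integral>w. f (Y w) \<partial>N) < c"
      then show "\<forall>\<^sub>F n in sequentially. (\<integral>w. f (X n w) \<partial>M) < c"
        using low[OF mf, of B "c - (\<integral>w. f (Y w) \<partial>N)"] B by simp
    qed
  qed
  then show ?thesis by (simp add: converges_in_distr_def)
qed

section \<open>Partial sums in a domain of attraction and their Skorohod coupling\<close>

text \<open>The common setting of the walk and of each half of the medium.
  \<open>char_nonzero\<close> is the trace of stability that is kept: it permits the division by the
  limiting characteristic function when the Levy marginals are identified.\<close>

locale attracted_sums = prob_space M
  for M :: "'a measure" +
  fixes X :: "nat \<Rightarrow> 'a \<Rightarrow> real" and \<alpha> :: real and P :: "real measure"
  assumes iid: "iid M borel {1..} X"
    and attracted: "normally_attracted M X \<alpha> P"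
    and index_pos: "0 < \<alpha>"
    and limit_distr: "real_distribution P"
    and char_nonzero: "char P \<theta> \<noteq> 0"
begin

lemma indep: "D \<subseteq> {1..} \<Longrightarrow> indep_vars (\<lambda>_. borel) X D"
  using iid indep_vars_subset unfolding iid_def by blast

lemma rv [measurable]: "1 \<le> i \<Longrightarrow> random_variable borel (X i)"
  using iid unfolding iid_def indep_vars_def by simp

lemma same_distr: "1 \<le> i \<Longrightarrow> distr M borel (X i) = distr M borel (X 1)"
  using iid unfolding iid_def by (meson atLeast_iff order_refl)

lemma rv_sum [measurable]: "D \<subseteq> {1..} \<Longrightarrow> random_variable borel (\<lambda>w. \<Sum>i\<in>D. X i w)"
  by (rule borel_measurable_sum) auto

lemma distr_block_sum:
  assumes "D \<subseteq> {1..}" "finite D"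
  shows "distr M borel (\<lambda>w. \<Sum>i\<in>D. X i w) = distr M borel (\<lambda>w. \<Sum>i=1..card D. X i w)"
proof (rule distr_iid_sum_cong[OF prob_space_axioms])
  show "distr M borel (X i) = distr M borel (X 1)" if "i \<in> D" for i
    using that assms same_distr[of i] by auto
  show "distr M borel (X i) = distr M borel (X 1)" if "i \<in> {1..card D}" for i
    using that same_distr[of i] by auto
qed (use assms in \<open>auto intro!: indep\<close>)

end

text \<open>Skorohod's representation turns the attraction into pointwise convergence.  At \<open>s = 0\<close> the
  sample sizes \<open>m n\<close> need not tend to infinity, but the convergent sequence \<open>Y\<close> is bounded.\<close>

locale coupled_sums = attracted_sums M X \<alpha> P + \<Omega>: prob_space \<Omega>
  for M :: "'a measure" and X \<alpha> P and \<Omega> :: "real measure" +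
  fixes Y :: "nat \<Rightarrow> real \<Rightarrow> real" and Y_lim :: "real \<Rightarrow> real"
  assumes Y_rv [measurable]: "Y n \<in> borel_measurable \<Omega>" "Y_lim \<in> borel_measurable \<Omega>"
    and distr_Y: "distr \<Omega> borel (Y n) = distr M borel (\<lambda>w. (\<Sum>i=1..n. X i w) / real n powr (1 / \<alpha>))"
    and distr_Y_lim: "distr \<Omega> borel Y_lim = P"
    and Y_tendsto: "x \<in> space \<Omega> \<Longrightarrow> (\<lambda>n. Y n x) \<longlonglongrightarrow> Y_lim x"
begin

text \<open>A copy of a sum of \<open>m\<close> terms divided by
  \<open>c powr (1 / \<alpha>)\<close>: the prefactor trades the normalisation by the number of
  terms for the common one. For \<open>m = 0\<close> it is zero, as the empty sum requires.\<close>

definition scaled :: "real \<Rightarrow> nat \<Rightarrow> real \<Rightarrow> real" where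
  "scaled c m x = (real m / c) powr (1 / \<alpha>) * Y m x"

lemma scaled_rv [measurable]: "scaled c m \<in> borel_measurable \<Omega>"
  unfolding scaled_def by measurable

lemma distr_scaled:
  assumes D: "D \<subseteq> {1..}" "finite D" and c: "0 \<le> c"
  shows "distr M borel (\<lambda>w. (\<Sum>i\<in>D. X i w) / c powr (1 / \<alpha>)) = distr \<Omega> borel (scaled c (card D))"
proof -
  let ?m = "card D"
  have [measurable]: "(\<lambda>w. \<Sum>i\<in>D. X i w) \<in> borel_measurable M" using D by simp
  have [measurable]: "(\<lambda>w. \<Sum>i=1..?m. X i w) \<in> borel_measurable M" by (rule rv_sum) auto
  have "distr M borel (\<lambda>w. (\<Sum>i\<in>D. X i w) / c powr (1 / \<alpha>))
      = distr M borel (\<lambda>w. (\<Sum>i=1..?m. X i w) / c powr (1 / \<alpha>))"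
    using distr_scale_cong[OF _ _ distr_block_sum[OF D], of "1 / c powr (1 / \<alpha>)"] by simp
  also have "\<dots> = distr M borel (\<lambda>w. (real ?m / c) powr (1 / \<alpha>) *
      ((\<Sum>i=1..?m. X i w) / real ?m powr (1 / \<alpha>)))"
    using c by (intro arg_cong[where f="distr M borel"] ext) (cases "?m = 0"; simp add: powr_divide)
  also have "\<dots> = distr \<Omega> borel (scaled c ?m)"
    unfolding scaled_def by (rule distr_scale_cong) (auto simp: distr_Y)
  finally show ?thesis .
qed

lemma scaled_tendsto:
  assumes x: "x \<in> space \<Omega>" and c: "filterlim c at_top sequentially"
    and m: "(\<lambda>n. real (m n) / c n) \<longlonglongrightarrow> s"
  shows "(\<lambda>n. scaled (c n) (m n) x) \<longlonglongrightarrow> s powr (1 / \<alpha>) * Y_lim x"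
proof -
  have pos: "\<forall>\<^sub>F n in sequentially. 0 < c n"
    using c by (simp add: filterlim_at_top_dense)
  have s: "0 \<le> s"
  proof (rule tendsto_lowerbound[OF m])
    show "\<forall>\<^sub>F n in sequentially. 0 \<le> real (m n) / c n" using pos by eventually_elim simp
  qed simp
  have root: "(\<lambda>n. (real (m n) / c n) powr (1 / \<alpha>)) \<longlonglongrightarrow> s powr (1 / \<alpha>)"
  proof (rule tendsto_powr2[OF m tendsto_const])
    show "\<forall>\<^sub>F n in sequentially. 0 \<le> real (m n) / c n" using pos by eventually_elim simp
  qed (use index_pos in auto)
  show ?thesis
  proof (cases "s = 0")
    case True
    have "Bseq (\<lambda>n. Y n x)" using Y_tendsto[OF x] convergentI convergent_imp_Bseq by blast
    then obtain K where K: "\<And>n. \<bar>Y n x\<bar> \<le> K" by (auto simp: Bseq_def)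
    have "(\<lambda>n. scaled (c n) (m n) x) \<longlonglongrightarrow> 0"
    proof (rule Lim_null_comparison)
      show "(\<lambda>n. (real (m n) / c n) powr (1 / \<alpha>) * K) \<longlonglongrightarrow> 0"
        using tendsto_mult_right[OF root, of K] True by simp
      show "\<forall>\<^sub>F n in sequentially. norm (scaled (c n) (m n) x) \<le> (real (m n) / c n) powr (1 / \<alpha>) * K"
        unfolding scaled_def by (auto simp: abs_mult K intro!: always_eventually mult_left_mono)
    qed
    then show ?thesis using True by simp
  next
    case False
    have "filterlim (\<lambda>n. real (m n) / c n * c n) at_top sequentially"
      by (rule filterlim_tendsto_pos_mult_at_top[OF m _ c]) (use s False in auto)
    then have "filterlim (\<lambda>n. real (m n)) at_top sequentially"
      by (rule filterlim_mono_eventually) (use pos in \<open>auto elim: eventually_mono\<close>)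
    then have "filterlim m sequentially sequentially"
      by (simp add: filterlim_sequentially_iff_filterlim_real)
    then show ?thesis
      unfolding scaled_def
      by (intro tendsto_mult root filterlim_compose[OF Y_tendsto[OF x]])
  qed
qed

end

lemma (in attracted_sums) coupled_sums_exists:
  obtains \<Omega> Y Y_lim where "coupled_sums M X \<alpha> P \<Omega> Y Y_lim"
proof -
  let ?\<mu> = "\<lambda>n. distr M borel (\<lambda>w. (\<Sum>i=1..n. X i w) / real n powr (1 / \<alpha>))"
  have [measurable]: "(\<lambda>w. \<Sum>i=1..n. X i w) \<in> borel_measurable M" for n by (rule rv_sum) auto
  have rd: "real_distribution (?\<mu> n)" for n by (rule real_distribution_distr) measurable
  obtain \<Omega> :: "real measure" and Y Y_lim where
    "prob_space \<Omega>" "\<And>n. Y n \<in> borel_measurable \<Omega>" "\<And>n. distr \<Omega> borel (Y n) = ?\<mu> n"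
    "Y_lim \<in> measurable \<Omega> lborel" "distr \<Omega> borel Y_lim = P"
    "\<And>x. x \<in> space \<Omega> \<Longrightarrow> (\<lambda>n. Y n x) \<longlonglongrightarrow> Y_lim x"
    using Skorohod[OF rd limit_distr attracted[unfolded normally_attracted_def]] by blast
  then have "coupled_sums M X \<alpha> P \<Omega> Y Y_lim"
    by (auto simp: coupled_sums_def coupled_sums_axioms_def attracted_sums_axioms)
  then show ?thesis by (rule that)
qed

section \<open>Marginals of a stable Levy process\<close>

text \<open>The added 1 keeps the grid points strictly above \<open>t\<close>, so that
  right-continuity, the continuity that cadlag paths offer, applies along them. They serve as
  rational times for characteristic functions and as countably many evaluation points for
  \<open>Z\<close>.\<close>

lemma filterlim_grid_at_right:
  "filterlim (\<lambda>n. (real_of_int \<lfloor>real (Suc n) * t\<rfloor> + 1) / real (Suc n)) (at_right t) sequentially"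
proof -
  define q where "q n = (real_of_int \<lfloor>real (Suc n) * t\<rfloor> + 1) / real (Suc n)" for n
  have gt: "t < q n" for n
  proof -
    have "real (Suc n) * t < real_of_int \<lfloor>real (Suc n) * t\<rfloor> + 1" by linarith
    then show ?thesis unfolding q_def by (subst pos_less_divide_eq) (simp_all add: mult.commute)
  qed
  have le: "q n \<le> t + inverse (real (Suc n))" for n
  proof -
    have "real_of_int \<lfloor>real (Suc n) * t\<rfloor> + 1 \<le> real (Suc n) * t + 1" by linarith
    then have "q n \<le> (real (Suc n) * t + 1) / real (Suc n)"
      unfolding q_def by (rule divide_right_mono) simp
    also have "\<dots> = t + inverse (real (Suc n))"
      by (simp only: add_divide_distrib inverse_eq_divide) simp
    finally show ?thesis .
  qed
  have "(\<lambda>n. t + inverse (real (Suc n))) \<longlonglongrightarrow> t + 0"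
    by (intro tendsto_intros LIMSEQ_inverse_real_of_nat)
  then have up: "(\<lambda>n. t + inverse (real (Suc n))) \<longlonglongrightarrow> t" by simp
  have "q \<longlonglongrightarrow> t"
    by (rule tendsto_sandwich[OF _ _ tendsto_const up])
      (rule always_eventually, intro allI le less_imp_le[OF gt])+
  then have "filterlim q (at_right t) sequentially"
    using gt by (auto simp: filterlim_at intro: always_eventually)
  then show ?thesis unfolding q_def .
qed

lemma floor_ratio_tendsto:
  assumes c: "filterlim c at_top sequentially" and s: "s \<longlonglongrightarrow> l"
  shows "(\<lambda>n. real_of_int \<lfloor>c n * s n\<rfloor> / c n) \<longlonglongrightarrow> l"
proof -
  have pos: "\<forall>\<^sub>F n in sequentially. 0 < c n"
    using c by (simp add: filterlim_at_top_dense)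
  have "(\<lambda>n. real_of_int \<lfloor>c n * s n\<rfloor> / c n - s n) \<longlonglongrightarrow> 0"
  proof (rule Lim_null_comparison)
    show "(\<lambda>n. inverse (c n)) \<longlonglongrightarrow> 0"
      by (rule tendsto_inverse_0_at_top[OF c])
    show "\<forall>\<^sub>F n in sequentially. norm (real_of_int \<lfloor>c n * s n\<rfloor> / c n - s n) \<le> inverse (c n)"
      using pos
    proof eventually_elim
      case (elim n)
      have "\<bar>real_of_int \<lfloor>c n * s n\<rfloor> - c n * s n\<bar> \<le> 1" by linarith
      then have "\<bar>real_of_int \<lfloor>c n * s n\<rfloor> - c n * s n\<bar> / c n \<le> 1 / c n"
        using elim by (intro divide_right_mono) auto
      moreover have "real_of_int \<lfloor>c n * s n\<rfloor> / c n - s n = (real_of_int \<lfloor>c n * s n\<rfloor> - c n * s n) / c n"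
        using elim by (simp add: diff_divide_distrib)
      ultimately show ?case using elim by (simp add: abs_divide inverse_eq_divide)
    qed
  qed
  from tendsto_add[OF this s] show ?thesis by simp
qed

lemma nat_floor_ratio_tendsto:
  assumes c: "filterlim c at_top sequentially" and s: "0 \<le> s"
  shows "(\<lambda>n. real (nat \<lfloor>c n * s\<rfloor>) / c n) \<longlonglongrightarrow> s"
proof -
  have "\<forall>\<^sub>F n in sequentially. 0 \<le> c n"
    using c by (simp add: filterlim_at_top)
  then have "\<forall>\<^sub>F n in sequentially. real_of_int \<lfloor>c n * s\<rfloor> / c n = real (nat \<lfloor>c n * s\<rfloor>) / c n"
    by eventually_elim (use s in simp)
  then show ?thesis using floor_ratio_tendsto[OF c tendsto_const] by (rule Lim_transform_eventually[rotated])
qed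

text \<open>The ratio of two \<open>k\<close>-th roots of the same nonvanishing function is a continuous function with
  values in the finite set of \<open>k\<close>-th roots of unity.\<close>

lemma multiplicative_family_unique:
  fixes u v :: "real \<Rightarrow> real \<Rightarrow> complex"
  assumes u_add: "\<And>s t \<theta>. 0 < s \<Longrightarrow> 0 < t \<Longrightarrow> u (s + t) \<theta> = u s \<theta> * u t \<theta>"
    and v_add: "\<And>s t \<theta>. 0 < s \<Longrightarrow> 0 < t \<Longrightarrow> v (s + t) \<theta> = v s \<theta> * v t \<theta>"
    and cont: "\<And>t. 0 < t \<Longrightarrow> continuous_on UNIV (u t)" "\<And>t. 0 < t \<Longrightarrow> continuous_on UNIV (v t)"
    and zero: "\<And>t. 0 < t \<Longrightarrow> u t 0 = 1" "\<And>t. 0 < t \<Longrightarrow> v t 0 = 1"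
    and right: "\<And>t \<theta>. 0 < t \<Longrightarrow> ((\<lambda>s. u s \<theta>) \<longlongrightarrow> u t \<theta>) (at_right t)"
      "\<And>t \<theta>. 0 < t \<Longrightarrow> ((\<lambda>s. v s \<theta>) \<longlongrightarrow> v t \<theta>) (at_right t)"
    and nonzero: "\<And>t \<theta>. 0 < t \<Longrightarrow> v t \<theta> \<noteq> 0"
    and one: "\<And>\<theta>. u 1 \<theta> = v 1 \<theta>"
    and t: "0 < t"
  shows "u t \<theta> = v t \<theta>"
proof -
  define g where "g t \<theta> = u t \<theta> / v t \<theta>" for t \<theta>
  have g_add: "g (s + t) \<theta> = g s \<theta> * g t \<theta>" if "0 < s" "0 < t" for s t \<theta>
    using that by (simp add: g_def u_add v_add)
  have g_power: "g (real (Suc k) * t) \<theta> = g t \<theta> ^ Suc k" if "0 < t" for k t \<theta>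
  proof (induction k)
    case (Suc k)
    have "g (real (Suc (Suc k)) * t) \<theta> = g (t + real (Suc k) * t) \<theta>"
      by (simp add: algebra_simps)
    also have "\<dots> = g t \<theta> * g (real (Suc k) * t) \<theta>"
      by (rule g_add) (use that in \<open>auto intro!: mult_pos_pos simp del: of_nat_Suc\<close>)
    finally show ?case by (simp only: Suc power_Suc)
  qed simp
  have root: "g (1 / real (Suc k)) \<theta> = 1" for k \<theta>
  proof -
    let ?h = "1 / real (Suc k)"
    have "g ?h \<theta> ^ Suc k = 1" for \<theta>
    proof -
      have "g ?h \<theta> ^ Suc k = g (real (Suc k) * ?h) \<theta>" by (rule g_power[symmetric]) simp
      also have "\<dots> = 1" using one[of \<theta>] nonzero[of 1 \<theta>] by (simp add: g_def)
      finally show ?thesis .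
    qed
    then have "finite (range (g ?h))"
      by (intro finite_subset[OF _ finite_nth_roots[of "Suc k" 1]]) auto
    moreover have "continuous_on UNIV (g ?h)"
      unfolding g_def[abs_def] by (intro continuous_on_divide cont) (auto simp: nonzero)
    ultimately have "g ?h constant_on UNIV"
      by (intro continuous_finite_range_constant) auto
    \<comment> \<open>Constancy in \<theta> selects the root of unity taken at \<theta> = 0, where
      both functions are 1.\<close>
    then have "g ?h \<theta> = g ?h 0" by (auto simp: constant_on_def)
    also have "\<dots> = 1" by (simp add: g_def zero)
    finally show ?thesis .
  qed
  have g_rat: "g (real (Suc p) / real (Suc k)) \<theta> = 1" for p k
  proof -
    have "g (real (Suc p) * (1 / real (Suc k))) \<theta> = g (1 / real (Suc k)) \<theta> ^ Suc p"
      by (rule g_power) simp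
    then show ?thesis by (simp only: root power_one times_divide_eq_right mult_1_right)
  qed
  \<comment> \<open>Positive rationals decreasing to \<open>t\<close>: the quotient is 1 at each of
    them, and right limits in time carry this to \<open>t\<close>.\<close>
  let ?q = "\<lambda>n. (real_of_int \<lfloor>real (Suc n) * t\<rfloor> + 1) / real (Suc n)"
  have q: "g (?q n) \<theta> = 1" for n
  proof -
    have "0 \<le> \<lfloor>real (Suc n) * t\<rfloor>" using t by simp
    then have "real_of_int \<lfloor>real (Suc n) * t\<rfloor> + 1 = real (Suc (nat \<lfloor>real (Suc n) * t\<rfloor>))" by simp
    then show ?thesis by (simp only: g_rat)
  qed
  have "((\<lambda>s. g s \<theta>) \<longlongrightarrow> g t \<theta>) (at_right t)"
    unfolding g_def using t by (intro tendsto_divide right nonzero)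
  then have "(\<lambda>n. g (?q n) \<theta>) \<longlonglongrightarrow> g t \<theta>"
    by (rule filterlim_compose[OF _ filterlim_grid_at_right])
  then have "g t \<theta> = 1" unfolding q by (simp add: LIMSEQ_const_iff)
  then show ?thesis using nonzero[OF t] by (simp add: g_def)
qed

lemma char_distr:
  "X \<in> borel_measurable M \<Longrightarrow> char (distr M borel X) \<theta> = (\<integral>w. iexp (\<theta> * X w) \<partial>M)"
  by (simp add: char_def integral_distr)

lemma char_distr_scale:
  assumes [measurable]: "X \<in> borel_measurable M"
  shows "char (distr M borel (\<lambda>w. c * X w)) \<theta> = char (distr M borel X) (c * \<theta>)"
  by (simp add: char_distr mult.assoc mult.left_commute)

lemma levy_rv: "levy_process N L \<Longrightarrow> 0 \<le> t \<Longrightarrow> L t \<in> borel_measurable N"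
  by (simp add: levy_process_def)

lemma levy_zero: "levy_process N L \<Longrightarrow> w \<in> space N \<Longrightarrow> L 0 w = 0"
  by (simp add: levy_process_def)

lemma levy_indep_increments:
  "levy_process N L \<Longrightarrow> 0 \<le> t 0 \<Longrightarrow> (\<And>i. i < k \<Longrightarrow> t i < t (Suc i)) \<Longrightarrow>
    prob_space.indep_vars N (\<lambda>_. borel) (\<lambda>i w. L (t (Suc i)) w - L (t i) w) {..<k}"
  unfolding levy_process_def by blast

lemma levy_increment_distr:
  assumes "levy_process N L" "0 \<le> s" "s \<le> t"
  shows "distr N borel (\<lambda>w. L t w - L s w) = distr N borel (L (t - s))"
proof -
  have "0 \<le> t - s" using assms by simp
  then have "distr N borel (\<lambda>w. L (s + (t - s)) w - L s w) = distr N borel (L (t - s))"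
    using assms unfolding levy_process_def by blast
  then show ?thesis by simp
qed

lemma levy_tendsto_at_right:
  "levy_process N L \<Longrightarrow> w \<in> space N \<Longrightarrow> 0 \<le> t \<Longrightarrow> ((\<lambda>s. L s w) \<longlongrightarrow> L t w) (at_right t)"
  by (simp add: levy_process_def cadlag_def)

lemma levy_char_add:
  assumes N: "prob_space N" and L: "levy_process N L" and s: "0 < s" and t: "0 < t"
  shows "char (distr N borel (L (s + t))) \<theta> = char (distr N borel (L s)) \<theta> * char (distr N borel (L t)) \<theta>"
proof -
  interpret prob_space N by fact
  define \<tau> where "\<tau> i = (if i = 0 then 0 else if i = Suc 0 then s else s + t)" for i :: nat
  let ?D = "\<lambda>i w. L (\<tau> (Suc i)) w - L (\<tau> i) w"
  have "indep_vars (\<lambda>_. borel) ?D {..<2}"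
    by (rule levy_indep_increments[OF L]) (use s t in \<open>auto simp: \<tau>_def\<close>)
  then have "char (distr N borel (\<lambda>w. \<Sum>i<2. ?D i w)) \<theta> = (\<Prod>i<2. char (distr N borel (?D i)) \<theta>)"
    by (rule char_distr_sum)
  moreover have "distr N borel (?D 0) = distr N borel (L s)"
    using levy_increment_distr[OF L, of 0 s] s by (simp add: \<tau>_def)
  moreover have "distr N borel (?D 1) = distr N borel (L t)"
    using levy_increment_distr[OF L, of s "s + t"] s t by (simp add: \<tau>_def)
  moreover have "distr N borel (\<lambda>w. \<Sum>i<2. ?D i w) = distr N borel (L (s + t))"
    using levy_increment_distr[OF L, of 0 "s + t"] s t by (simp add: \<tau>_def numeral_2_eq_2)
  ultimately show ?thesis by (simp add: numeral_2_eq_2)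
qed

lemma levy_char_at_right:
  assumes N: "prob_space N" and L: "levy_process N L" and t: "0 < t"
  shows "((\<lambda>s. char (distr N borel (L s)) \<theta>) \<longlongrightarrow> char (distr N borel (L t)) \<theta>) (at_right t)"
proof (rule tendsto_at_right_sequentially[of t "t + 1"])
  interpret prob_space N by fact
  fix S assume S: "\<And>n. t < S n" "S \<longlonglongrightarrow> t"
  have [measurable]: "random_variable borel (L t)" "\<And>n. random_variable borel (L (S n))"
    using levy_rv[OF L] t S(1) by (auto intro: less_imp_le less_trans)
  have "filterlim S (at_right t) sequentially"
    using S by (auto simp: filterlim_at intro: always_eventually)
  then have "(\<lambda>n. L (S n) w) \<longlonglongrightarrow> L t w" if "w \<in> space N" for w
    using levy_tendsto_at_right[OF L that, of t] t filterlim_compose by fastforce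
  then have "(\<lambda>n. expectation (\<lambda>w. iexp (\<theta> * L (S n) w))) \<longlonglongrightarrow> expectation (\<lambda>w. iexp (\<theta> * L t w))"
    by (intro integral_dominated_convergence[where w="\<lambda>_. 1"]) (auto intro!: AE_I2 tendsto_intros)
  then show "(\<lambda>n. char (distr N borel (L (S n))) \<theta>) \<longlonglongrightarrow> char (distr N borel (L t)) \<theta>"
    by (simp add: char_distr)
qed simp

context coupled_sums
begin

lemma scaled_char_tendsto:
  assumes c: "filterlim c at_top sequentially" and m: "(\<lambda>n. real (m n) / c n) \<longlonglongrightarrow> s"
  shows "(\<lambda>n. char (distr \<Omega> borel (scaled (c n) (m n))) \<theta>) \<longlonglongrightarrow> char P (s powr (1 / \<alpha>) * \<theta>)"
proof -
  have "(\<lambda>n. \<Omega>.expectation (\<lambda>x. iexp (\<theta> * scaled (c n) (m n) x))) \<longlonglongrightarrow>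
      \<Omega>.expectation (\<lambda>x. iexp (\<theta> * (s powr (1 / \<alpha>) * Y_lim x)))"
    by (rule integral_dominated_convergence[where w="\<lambda>_. 1"])
      (intro AE_I2 tendsto_intros scaled_tendsto[OF _ c m] | simp)+
  moreover have "\<Omega>.expectation (\<lambda>x. iexp (\<theta> * (s powr (1 / \<alpha>) * Y_lim x))) = char P (s powr (1 / \<alpha>) * \<theta>)"
    by (subst char_distr[symmetric]) (auto simp: char_distr_scale distr_Y_lim)
  ultimately show ?thesis by (simp add: char_distr)
qed

text \<open>The first \<open>m s n + m t n\<close> summands split into two independent consecutive
  blocks of asymptotic relative lengths \<open>s\<close> and \<open>t\<close>. Factorising the
  characteristic function before the limit gives the semigroup property of the limit law.\<close>

lemma char_limit_add:
  assumes s: "0 \<le> s" and t: "0 \<le> t"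
  shows "char P ((s + t) powr (1 / \<alpha>) * \<theta>) = char P (s powr (1 / \<alpha>) * \<theta>) * char P (t powr (1 / \<alpha>) * \<theta>)"
proof -
  define m where "m r n = nat \<lfloor>real n * r\<rfloor>" for r n
  have m: "(\<lambda>n. real (m r n) / real n) \<longlonglongrightarrow> r" if "0 \<le> r" for r
    unfolding m_def by (rule nat_floor_ratio_tendsto[OF filterlim_real_sequentially that])
  let ?D = "\<lambda>n. {Suc (m s n)..m s n + m t n}"
  let ?S = "\<lambda>D n w. (\<Sum>i\<in>D n. X i w) / real n powr (1 / \<alpha>)"
  have [measurable]: "random_variable borel (?S D n)" if "D n \<subseteq> {1..}" for D n
    using rv_sum[OF that] by measurable
  have split: "char (distr M borel (?S (\<lambda>n. {1..m s n + m t n}) n)) \<theta> =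
      char (distr M borel (?S (\<lambda>n. {1..m s n}) n)) \<theta> * char (distr M borel (?S ?D n)) \<theta>" for n
  proof -
    have "indep_vars (\<lambda>_. borel) (\<lambda>i w. X i w / real n powr (1 / \<alpha>)) {1..m s n + m t n}"
      by (rule indep_vars_compose2[OF indep]) auto
    note ch = char_distr_sum[OF indep_vars_subset[OF this]]
    have un: "{1..m s n + m t n} = {1..m s n} \<union> ?D n" "{1..m s n} \<inter> ?D n = {}" by auto
    have "prod h {1..m s n + m t n} = prod h {1..m s n} * prod h (?D n)" for h :: "nat \<Rightarrow> complex"
      unfolding un(1) by (rule prod.union_disjoint) (use un(2) in auto)
    then show ?thesis
      unfolding sum_divide_distrib by (subst (1 2 3) ch) auto
  qed
  have lim: "(\<lambda>n. char (distr M borel (?S D n)) \<theta>) \<longlonglongrightarrow> char P (r powr (1 / \<alpha>) * \<theta>)"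
    if D: "\<And>n. D n \<subseteq> {1..}" "\<And>n. finite (D n)" and r: "(\<lambda>n. real (card (D n)) / real n) \<longlonglongrightarrow> r" for D r
  proof -
    have eq: "distr M borel (?S D n) = distr \<Omega> borel (scaled (real n) (card (D n)))" for n
      by (rule distr_scaled[OF D]) simp
    show ?thesis unfolding eq by (rule scaled_char_tendsto[OF filterlim_real_sequentially r])
  qed
  \<comment> \<open>The total length may differ from \<open>m (s + t) n\<close>, since floors are
    not additive; its ratio to \<open>n\<close> still tends to \<open>s + t\<close>.\<close>
  have "(\<lambda>n. real (m s n + m t n) / real n) \<longlonglongrightarrow> s + t"
    using tendsto_add[OF m[OF s] m[OF t]] by (simp add: add_divide_distrib)
  then have "(\<lambda>n. char (distr M borel (?S (\<lambda>n. {1..m s n + m t n}) n)) \<theta>)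
      \<longlonglongrightarrow> char P ((s + t) powr (1 / \<alpha>) * \<theta>)"
    by (intro lim) auto
  moreover have "(\<lambda>n. char (distr M borel (?S (\<lambda>n. {1..m s n + m t n}) n)) \<theta>)
      \<longlonglongrightarrow> char P (s powr (1 / \<alpha>) * \<theta>) * char P (t powr (1 / \<alpha>) * \<theta>)"
    unfolding split by (intro tendsto_mult lim) (use m[OF s] m[OF t] in auto)
  ultimately show ?thesis by (rule LIMSEQ_unique)
qed

lemma levy_marginal_distr:
  assumes N: "prob_space N" and L: "levy_process N L" and one: "distr N borel (L 1) = P"
    and t: "0 \<le> t"
  shows "distr N borel (L t) = distr \<Omega> borel (\<lambda>x. t powr (1 / \<alpha>) * Y_lim x)"
proof -
  interpret N: prob_space N by fact
  interpret P: real_distribution P by (rule limit_distr)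
  have Lrv [measurable]: "L s \<in> borel_measurable N" if "0 \<le> s" for s using levy_rv[OF L that] .
  have rd: "real_distribution (distr N borel (L s))" if "0 \<le> s" for s
    using that by (intro N.real_distribution_distr) simp
  have char_eq: "char (distr N borel (L t)) \<theta> = char P (t powr (1 / \<alpha>) * \<theta>)" for \<theta>
  \<comment> \<open>The uniqueness lemma concerns positive times. At time 0 the process is 0 and
    \<open>0 powr (1 / \<alpha>)\<close> is 0, so both characteristic functions equal 1.\<close>
  proof (cases "t = 0")
    case True
    have "char (distr N borel (L t)) \<theta> = N.expectation (\<lambda>w. iexp (\<theta> * 0))"
      unfolding True
      by (subst char_distr) (auto intro!: Bochner_Integration.integral_cong simp only: levy_zero[OF L] Lrv)
    then show ?thesis using True by (simp add: P.char_zero N.prob_space)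
  next
    case False
    then have "0 < t" using t by simp
    then show ?thesis
    proof (rule multiplicative_family_unique[rotated -1,
        where u="\<lambda>t. char (distr N borel (L t))" and v="\<lambda>t \<theta>. char P (t powr (1 / \<alpha>) * \<theta>)"])
      show "continuous_on UNIV (char (distr N borel (L t)))" if "0 < t" for t
        using real_distribution.isCont_char[OF rd] that by (auto intro: continuous_at_imp_continuous_on)
      have cP: "continuous_on UNIV (char P)"
        using P.isCont_char by (auto intro: continuous_at_imp_continuous_on)
      show "continuous_on UNIV (\<lambda>\<theta>. char P (t powr (1 / \<alpha>) * \<theta>))" for t
        by (rule continuous_on_compose2[OF cP]) (auto intro!: continuous_intros)
      show "((\<lambda>s. char P (s powr (1 / \<alpha>) * \<theta>)) \<longlongrightarrow> char P (t powr (1 / \<alpha>) * \<theta>)) (at_right t)"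
        if "0 < t" for t \<theta>
        using that by (intro isCont_tendsto_compose[OF P.isCont_char] tendsto_intros) auto
    qed (use L N rd in \<open>auto simp: levy_char_add char_limit_add P.char_zero char_nonzero one
        real_distribution.char_zero intro!: levy_char_at_right\<close>)
  qed
  show ?thesis
  proof (rule Levy_uniqueness)
    show "char (distr N borel (L t)) = char (distr \<Omega> borel (\<lambda>x. t powr (1 / \<alpha>) * Y_lim x))"
      by (rule ext) (simp add: char_eq char_distr_scale distr_Y_lim)
  qed (use t rd in \<open>auto intro!: \<Omega>.real_distribution_distr\<close>)
qed

end

section \<open>Coupling of finite-dimensional distributions\<close>

lemma measurable_PiM_UNIV_I:
  assumes "\<And>i. (\<lambda>w. f w i) \<in> borel_measurable M"
  shows "f \<in> measurable M (PiM UNIV (\<lambda>_. borel))"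
proof -
  have "(\<lambda>w i. f w i) \<in> measurable M (PiM UNIV (\<lambda>_. borel))"
    by (rule measurable_PiM_single') (rule assms, auto)
  then show ?thesis .
qed

text \<open>The coordinate vector is the identity map of the product space, so its law is the
  product of the component laws, and this characterises independence.\<close>

lemma indep_vars_PiM_coordinates:
  assumes \<Omega>: "prob_space \<Omega>" and I: "I \<noteq> {}"
  shows "prob_space.indep_vars (PiM I (\<lambda>_. \<Omega>)) (\<lambda>_. \<Omega>) (\<lambda>i \<omega>. \<omega> i) I"
proof -
  interpret P: prob_space "PiM I (\<lambda>_. \<Omega>)" by (rule prob_space_PiM) (rule \<Omega>)
  have "distr (PiM I (\<lambda>_. \<Omega>)) (PiM I (\<lambda>_. \<Omega>)) (\<lambda>\<omega>. \<lambda>i\<in>I. \<omega> i) = distr (PiM I (\<lambda>_. \<Omega>)) (PiM I (\<lambda>_. \<Omega>)) (\<lambda>\<omega>. \<omega>)"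
    by (rule distr_cong) (auto simp: space_PiM)
  also have "\<dots> = PiM I (\<lambda>_. \<Omega>)" by (rule distr_id)
  also have "\<dots> = PiM I (\<lambda>i. distr (PiM I (\<lambda>_. \<Omega>)) \<Omega> (\<lambda>\<omega>. \<omega> i))"
    by (rule PiM_cong) (auto simp: distr_PiM_component[OF \<Omega>])
  finally show ?thesis
    by (subst P.indep_vars_iff_distr_eq_PiM'[OF I]) simp_all
qed

text \<open>Both vectors have as law the product of the same marginals. Independent variables are
  thereby realised as functions of separate coordinates, where one-dimensional pointwise couplings
  can be used side by side.\<close>

lemma distr_indep_eq_PiM:
  assumes N: "prob_space N" and \<Omega>: "prob_space \<Omega>" and I: "I \<noteq> {}"
    and A: "prob_space.indep_vars N (\<lambda>_. borel) A I"
    and g [measurable]: "\<And>i. i \<in> I \<Longrightarrow> g i \<in> borel_measurable \<Omega>"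
    and eq: "\<And>i. i \<in> I \<Longrightarrow> distr N borel (A i) = distr \<Omega> borel (g i)"
  shows "distr N (PiM I (\<lambda>_. borel)) (\<lambda>w. \<lambda>i\<in>I. A i w) =
    distr (PiM I (\<lambda>_. \<Omega>)) (PiM I (\<lambda>_. borel)) (\<lambda>\<omega>. \<lambda>i\<in>I. g i (\<omega> i))"
proof -
  interpret N: prob_space N by fact
  interpret P: prob_space "PiM I (\<lambda>_. \<Omega>)" by (rule prob_space_PiM) (rule \<Omega>)
  have rv: "A i \<in> borel_measurable N" if "i \<in> I" for i
    using A that by (simp add: N.indep_vars_def)
  have ind: "P.indep_vars (\<lambda>_. borel) (\<lambda>i \<omega>. g i (\<omega> i)) I"
    by (rule P.indep_vars_compose2[OF indep_vars_PiM_coordinates[OF \<Omega> I]]) simp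
  have comp: "distr (PiM I (\<lambda>_. \<Omega>)) borel (\<lambda>\<omega>. g i (\<omega> i)) = distr \<Omega> borel (g i)" if "i \<in> I" for i
  proof -
    have "distr (PiM I (\<lambda>_. \<Omega>)) borel (\<lambda>\<omega>. g i (\<omega> i)) =
        distr (distr (PiM I (\<lambda>_. \<Omega>)) \<Omega> (\<lambda>\<omega>. \<omega> i)) borel (g i)"
      using that by (subst distr_distr) (simp_all add: comp_def)
    then show ?thesis using that by (simp add: distr_PiM_component[OF \<Omega>])
  qed
  have "distr N (PiM I (\<lambda>_. borel)) (\<lambda>w. \<lambda>i\<in>I. A i w) = PiM I (\<lambda>i. distr N borel (A i))"
    by (rule iffD1[OF N.indep_vars_iff_distr_eq_PiM'[OF I] A]) (rule rv)
  also have "\<dots> = PiM I (\<lambda>i. distr (PiM I (\<lambda>_. \<Omega>)) borel (\<lambda>\<omega>. g i (\<omega> i)))"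
    by (rule PiM_cong) (simp_all add: eq comp)
  also have "\<dots> = distr (PiM I (\<lambda>_. \<Omega>)) (PiM I (\<lambda>_. borel)) (\<lambda>\<omega>. \<lambda>i\<in>I. g i (\<omega> i))"
    by (rule iffD1[OF P.indep_vars_iff_distr_eq_PiM'[OF I] ind, symmetric]) simp
  finally show ?thesis .
qed

lemma distr_compose_cong:
  assumes "F \<in> measurable M S" "G \<in> measurable N S" "distr M S F = distr N S G" "\<Phi> \<in> measurable S T"
  shows "distr M T (\<lambda>w. \<Phi> (F w)) = distr N T (\<lambda>w. \<Phi> (G w))"
  using distr_distr[OF assms(4,1)] distr_distr[OF assms(4,2)] assms(3) by (simp add: comp_def)

text \<open>Sums over disjoint blocks are independent, as are the increments of \<open>L\<close>, so
  each grid interval receives its own copy of \<Omega>. The sequence \<open>c\<close> counts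
  summands per unit of time: it is \<open>n\<close> for the walk and
  \<open>n powr (1 / \<alpha>)\<close>, with the index \<alpha> of the walk, for the medium.\<close>

lemma (in coupled_sums) fdd_coupling:
  fixes s :: "'i::finite \<Rightarrow> real"
  assumes c: "filterlim c at_top sequentially" "\<And>n. 0 \<le> c n"
    and s: "\<And>i. 0 \<le> s i"
    and N: "prob_space N" and L: "levy_process N L" and one: "distr N borel (L 1) = P"
  obtains \<Omega>' :: "(nat \<Rightarrow> real) measure" and U U_lim where
    "prob_space \<Omega>'"
    "\<And>n. U n \<in> measurable \<Omega>' (PiM UNIV (\<lambda>_. borel))" "U_lim \<in> measurable \<Omega>' (PiM UNIV (\<lambda>_. borel))"
    "\<And>n. distr M (PiM UNIV (\<lambda>_. borel))
      (\<lambda>w i. (\<Sum>j=1..nat \<lfloor>c n * s i\<rfloor>. X j w) / c n powr (1 / \<alpha>)) = distr \<Omega>' (PiM UNIV (\<lambda>_. borel)) (U n)"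
    "distr N (PiM UNIV (\<lambda>_. borel)) (\<lambda>w i. L (s i) w) = distr \<Omega>' (PiM UNIV (\<lambda>_. borel)) U_lim"
    "\<And>\<omega> i. \<omega> \<in> space \<Omega>' \<Longrightarrow> (\<lambda>n. U n \<omega> i) \<longlonglongrightarrow> U_lim \<omega> i"
proof -
  interpret N: prob_space N by fact
  have Lrv: "L r \<in> borel_measurable N" if "0 \<le> r" for r using levy_rv[OF L that] .
  \<comment> \<open>The point \<open>1\<close> only ensures that there is at least one increment.\<close>
  define T where "T = insert 0 (insert 1 (range s))"
  have T: "finite T" "\<And>r. r \<in> T \<Longrightarrow> 0 \<le> r" using s by (auto simp: T_def)
  \<comment> \<open>Repeated times collapse in the set \<open>T\<close>, which gives the strictly
    increasing grid that independence of the increments of \<open>L\<close> asks for;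
    \<open>\<iota>\<close> below sends each original index to its grid point.\<close>
  define \<tau> where "\<tau> l = sorted_list_of_set T ! l" for l
  have bij: "bij_betw \<tau> {..<card T} T"
    unfolding \<tau>_def[abs_def] by (rule bij_betw_nth) (simp_all add: T(1))
  have mono: "strict_mono_on {..<card T} \<tau>"
    by (rule strict_mono_onI) (simp add: \<tau>_def sorted_wrt_nth_less[OF strict_sorted_list_of_set])
  define k where "k = card T - 1"
  have "card {0, 1 :: real} \<le> card T" by (rule card_mono) (auto simp: T_def)
  then have card: "card T = Suc k" "0 < k" by (auto simp: k_def)
  have \<tau>_nonneg: "0 \<le> \<tau> l" if "l \<le> k" for l
    using bij_betwE[OF bij] T(2) that card by auto
  have \<tau>_less: "\<tau> l < \<tau> l'" if "l < l'" "l' \<le> k" for l l'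
    using strict_mono_onD[OF mono, of l l'] that card by auto
  have \<tau>_le: "\<tau> l \<le> \<tau> l'" if "l \<le> l'" "l' \<le> k" for l l'
    using \<tau>_less[of l l'] that by (cases "l = l'") auto
  have surj: "\<exists>l\<le>k. \<tau> l = r" if "r \<in> T" for r
    using bij that card unfolding bij_betw_def by (metis imageE lessThan_iff less_Suc_eq_le)
  have \<tau>_0: "\<tau> 0 = 0"
  proof -
    obtain l where "l \<le> k" "\<tau> l = 0" using surj[of 0] by (auto simp: T_def)
    then show ?thesis using \<tau>_le[of 0 l] \<tau>_nonneg[of 0] by simp
  qed
  have "\<forall>i. \<exists>l\<le>k. \<tau> l = s i" using surj by (auto simp: T_def)
  then obtain \<iota> where \<iota>: "\<And>i. \<iota> i \<le> k" "\<And>i. \<tau> (\<iota> i) = s i" by metis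
  define m where "m n l = nat \<lfloor>c n * \<tau> l\<rfloor>" for n l
  have m_mono: "m n l \<le> m n l'" if "l \<le> l'" "l' \<le> k" for n l l'
    unfolding m_def by (intro nat_mono floor_mono mult_left_mono \<tau>_le that c)
  have m_0: "m n 0 = 0" for n by (simp add: m_def \<tau>_0)
  define D where "D n l = {Suc (m n l)..m n (Suc l)}" for n l
  define A where "A n l w = (\<Sum>j\<in>D n l. X j w) / c n powr (1 / \<alpha>)" for n l w
  define g where "g n l = scaled (c n) (m n (Suc l) - m n l)" for n l
  define g' where "g' l x = (\<tau> (Suc l) - \<tau> l) powr (1 / \<alpha>) * Y_lim x" for l x
  \<comment> \<open>Recovers the values from the increments. Being one fixed measurable map, it
    transports equality of the laws of the increment vectors, for the sums as well as for
    \<open>L\<close>.\<close>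
  define \<Phi> where "\<Phi> a i = (\<Sum>l<\<iota> i. a l)" for a :: "nat \<Rightarrow> real" and i
  let ?\<Omega> = "PiM {..<k} (\<lambda>_. \<Omega>)" and ?B = "PiM {..<k} (\<lambda>_. borel :: real measure)"
    and ?S = "PiM (UNIV :: 'i set) (\<lambda>_. borel :: real measure)"
  have \<Phi>: "\<Phi> \<in> measurable ?B ?S"
    unfolding \<Phi>_def
  proof (intro measurable_PiM_UNIV_I borel_measurable_sum measurable_component_singleton)
    show "l \<in> {..<k}" if "l \<in> {..<\<iota> i}" for l i using that \<iota>(1)[of i] by simp
  qed
  have [measurable]: "g n l \<in> borel_measurable \<Omega>" "g' l \<in> borel_measurable \<Omega>" for n l
    unfolding g_def g'_def[abs_def] by measurable
  have ne: "{..<k} \<noteq> {}" using card by auto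
  have D: "D n l \<subseteq> {1..}" "finite (D n l)" "card (D n l) = m n (Suc l) - m n l" for n l
    by (auto simp: D_def)
  have disj: "disjoint_family_on (D n) {..<k}" for n
  proof -
    have *: "D n l \<inter> D n l' = {}" if "l < l'" "l' < k" for l l'
      using m_mono[of "Suc l" l' n] that by (auto simp: D_def)
    show ?thesis
      unfolding disjoint_family_on_def using * by (metis Int_commute lessThan_iff linorder_neqE_nat)
  qed
  have indA: "indep_vars (\<lambda>_. borel) (A n) {..<k}" for n
  proof -
    have "indep_vars (\<lambda>l. PiM (D n l) (\<lambda>_. borel)) (\<lambda>l w. restrict (\<lambda>j. X j w) (D n l)) {..<k}"
      by (rule indep_vars_restrict[OF indep[OF order_refl]]) (use D disj in auto)
    then have "indep_vars (\<lambda>_. borel)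
        (\<lambda>l w. (\<Sum>j\<in>D n l. restrict (\<lambda>j. X j w) (D n l) j) / c n powr (1 / \<alpha>)) {..<k}"
      by (rule indep_vars_compose2[where Y="\<lambda>l x. (\<Sum>j\<in>D n l. x j) / c n powr (1 / \<alpha>)"]) measurable
    then show ?thesis by (simp add: A_def[abs_def])
  qed
  have lawA: "distr M ?B (\<lambda>w. \<lambda>l\<in>{..<k}. A n l w) = distr ?\<Omega> ?B (\<lambda>\<omega>. \<lambda>l\<in>{..<k}. g n l (\<omega> l))" for n
  proof (rule distr_indep_eq_PiM[OF prob_space_axioms \<Omega>.prob_space_axioms ne indA])
    show "distr M borel (A n l) = distr \<Omega> borel (g n l)" for l
      unfolding A_def[abs_def] g_def using distr_scaled[OF D(1,2) c(2)] by (simp add: D(3))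
  qed simp
  let ?I = "\<lambda>l w. L (\<tau> (Suc l)) w - L (\<tau> l) w"
  have indL: "N.indep_vars (\<lambda>_. borel) ?I {..<k}"
    by (rule levy_indep_increments[OF L]) (auto simp: \<tau>_0 intro: \<tau>_less)
  have lawL: "distr N ?B (\<lambda>w. \<lambda>l\<in>{..<k}. ?I l w) = distr ?\<Omega> ?B (\<lambda>\<omega>. \<lambda>l\<in>{..<k}. g' l (\<omega> l))"
  proof (rule distr_indep_eq_PiM[OF N \<Omega>.prob_space_axioms ne indL])
    show "distr N borel (?I l) = distr \<Omega> borel (g' l)" if "l \<in> {..<k}" for l
    proof -
      have "0 \<le> \<tau> l" "\<tau> l \<le> \<tau> (Suc l)" using that \<tau>_nonneg[of l] \<tau>_le[of l "Suc l"] by auto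
      then show ?thesis
        unfolding g'_def[abs_def] using levy_increment_distr[OF L, of "\<tau> l" "\<tau> (Suc l)"]
        by (simp add: levy_marginal_distr[OF N L one])
    qed
  qed simp
  have sumA: "\<Phi> (\<lambda>l\<in>{..<k}. A n l w) = (\<lambda>i. (\<Sum>j=1..nat \<lfloor>c n * s i\<rfloor>. X j w) / c n powr (1 / \<alpha>))" for n w
  proof
    fix i
    have "(\<Sum>l<p. A n l w) = (\<Sum>j=1..m n p. X j w) / c n powr (1 / \<alpha>)" if "p \<le> k" for p
      using that
    proof (induction p)
      case (Suc p)
      have "{1..m n (Suc p)} = {1..m n p} \<union> D n p" "{1..m n p} \<inter> D n p = {}"
        using m_mono[of p "Suc p" n] Suc.prems by (auto simp: D_def)
      then have "(\<Sum>j=1..m n (Suc p). X j w) = (\<Sum>j=1..m n p. X j w) + (\<Sum>j\<in>D n p. X j w)"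
        by (simp add: sum.union_disjoint D(2))
      then show ?case using Suc by (simp add: A_def add_divide_distrib)
    qed (simp add: m_0)
    from this[OF \<iota>(1)[of i]]
    show "\<Phi> (\<lambda>l\<in>{..<k}. A n l w) i = (\<Sum>j=1..nat \<lfloor>c n * s i\<rfloor>. X j w) / c n powr (1 / \<alpha>)"
      using \<iota>(1)[of i] by (simp add: \<Phi>_def m_def \<iota>(2))
  qed
  have sumL: "\<Phi> (\<lambda>l\<in>{..<k}. ?I l w) = (\<lambda>i. L (s i) w)" if "w \<in> space N" for w
  proof
    fix i
    have "(\<Sum>l<p. ?I l w) = L (\<tau> p) w - L (\<tau> 0) w" for p
      by (rule sum_lessThan_telescope)
    then show "\<Phi> (\<lambda>l\<in>{..<k}. ?I l w) i = L (s i) w"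
      using \<iota>(1)[of i] by (simp add: \<Phi>_def \<iota>(2) \<tau>_0 levy_zero[OF L that])
  qed
  have rvA: "(\<lambda>w. \<lambda>l\<in>{..<k}. A n l w) \<in> measurable M ?B" for n
    using indA[of n] by (intro measurable_restrict) (auto simp: indep_vars_def)
  have rvL: "(\<lambda>w. \<lambda>l\<in>{..<k}. ?I l w) \<in> measurable N ?B"
    using indL by (intro measurable_restrict) (auto simp: N.indep_vars_def)
  have rvg: "(\<lambda>\<omega>. \<lambda>l\<in>{..<k}. g n l (\<omega> l)) \<in> measurable ?\<Omega> ?B"
    "(\<lambda>\<omega>. \<lambda>l\<in>{..<k}. g' l (\<omega> l)) \<in> measurable ?\<Omega> ?B" for n
    by (intro measurable_restrict; simp)+
  show ?thesis
  proof (rule that[of ?\<Omega> "\<lambda>n \<omega>. \<Phi> (\<lambda>l\<in>{..<k}. g n l (\<omega> l))" "\<lambda>\<omega>. \<Phi> (\<lambda>l\<in>{..<k}. g' l (\<omega> l))"])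
    show "prob_space ?\<Omega>" by (rule prob_space_PiM) (rule \<Omega>.prob_space_axioms)
    show "(\<lambda>\<omega>. \<Phi> (\<lambda>l\<in>{..<k}. g n l (\<omega> l))) \<in> measurable ?\<Omega> ?S" for n
      by (rule measurable_compose[OF rvg(1) \<Phi>])
    show "(\<lambda>\<omega>. \<Phi> (\<lambda>l\<in>{..<k}. g' l (\<omega> l))) \<in> measurable ?\<Omega> ?S"
      by (rule measurable_compose[OF rvg(2) \<Phi>])
    show "distr M ?S (\<lambda>w i. (\<Sum>j=1..nat \<lfloor>c n * s i\<rfloor>. X j w) / c n powr (1 / \<alpha>)) =
        distr ?\<Omega> ?S (\<lambda>\<omega>. \<Phi> (\<lambda>l\<in>{..<k}. g n l (\<omega> l)))" for n
      using distr_compose_cong[OF rvA rvg(1) lawA \<Phi>] by (simp add: sumA)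
    have "distr N ?S (\<lambda>w i. L (s i) w) = distr N ?S (\<lambda>w. \<Phi> (\<lambda>l\<in>{..<k}. ?I l w))"
      by (rule distr_cong) (simp_all add: sumL)
    also have "\<dots> = distr ?\<Omega> ?S (\<lambda>\<omega>. \<Phi> (\<lambda>l\<in>{..<k}. g' l (\<omega> l)))"
      by (rule distr_compose_cong[OF rvL rvg(2) lawL \<Phi>])
    finally show "distr N ?S (\<lambda>w i. L (s i) w) = distr ?\<Omega> ?S (\<lambda>\<omega>. \<Phi> (\<lambda>l\<in>{..<k}. g' l (\<omega> l)))" .
    fix \<omega> i assume \<omega>: "\<omega> \<in> space ?\<Omega>"
    have "(\<lambda>n. g n l (\<omega> l)) \<longlonglongrightarrow> g' l (\<omega> l)" if l: "l < k" for l
      unfolding g_def g'_def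
    proof (rule scaled_tendsto[OF _ c(1)])
      show "\<omega> l \<in> space \<Omega>" using \<omega> l by (auto simp: space_PiM)
      have "(\<lambda>n. real (m n (Suc l)) / c n - real (m n l) / c n) \<longlonglongrightarrow> \<tau> (Suc l) - \<tau> l"
        unfolding m_def using l by (intro tendsto_diff nat_floor_ratio_tendsto[OF c(1)] \<tau>_nonneg) auto
      then show "(\<lambda>n. real (m n (Suc l) - m n l) / c n) \<longlonglongrightarrow> \<tau> (Suc l) - \<tau> l"
        using l m_mono[of l "Suc l"] by (simp add: diff_divide_distrib)
    qed
    then show "(\<lambda>n. \<Phi> (\<lambda>l\<in>{..<k}. g n l (\<omega> l)) i) \<longlonglongrightarrow> \<Phi> (\<lambda>l\<in>{..<k}. g' l (\<omega> l)) i"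
      using \<iota>(1)[of i] unfolding \<Phi>_def by (intro tendsto_sum) auto
  qed
qed

section \<open>Independent processes\<close>

lemma borel_measurable_vec_lambdaI:
  fixes f :: "'a \<Rightarrow> 'm::finite \<Rightarrow> real"
  assumes "\<And>i. (\<lambda>w. f w i) \<in> borel_measurable M"
  shows "(\<lambda>w. \<chi> i. f w i) \<in> borel_measurable M"
proof -
  have "(\<lambda>w. (\<chi> i. f w i) \<bullet> b) \<in> borel_measurable M" if b: "b \<in> Basis" for b
  proof -
    obtain j where "b = axis j 1" using b by (auto simp: Basis_vec_def)
    then have "(\<lambda>w. (\<chi> i. f w i) \<bullet> b) = (\<lambda>w. f w j)" by (simp add: inner_axis)
    then show ?thesis by (simp only: assms)
  qed
  then show ?thesis by (subst borel_measurable_euclidean_space) blast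
qed

lemma integral_cong_distr:
  fixes h :: "'c \<Rightarrow> real"
  assumes "F \<in> measurable M S" "G \<in> measurable N S" "distr M S F = distr N S G"
    and "h \<in> borel_measurable S"
  shows "(\<integral>w. h (F w) \<partial>M) = (\<integral>w. h (G w) \<partial>N)"
  using integral_distr[OF assms(1,4)] integral_distr[OF assms(2,4)] assms(3) by simp

lemma sample_path_measurable:
  assumes "\<And>i. i \<in> I \<Longrightarrow> X i \<in> measurable M N"
  shows "sample_path I X \<in> measurable M (PiM I (\<lambda>_. N))"
  unfolding sample_path_def[abs_def] by (rule measurable_restrict) (rule assms)

lemma indep_processes_commute:
  assumes "prob_space M" "indep_processes M N1 I X N2 J Y"
  shows "indep_processes M N2 J Y N1 I X"
proof -
  interpret prob_space M by fact
  have "indep_set B A" if "indep_set A B" for A B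
    unfolding indep_sets2_eq
  proof (intro conjI ballI)
    show "B \<subseteq> events" "A \<subseteq> events" using that by (auto simp: indep_sets2_eq)
    fix b a assume "b \<in> B" "a \<in> A"
    then have "prob (a \<inter> b) = prob a * prob b" using indep_setD[OF that] by blast
    then show "prob (b \<inter> a) = prob b * prob a" by (simp only: Int_commute mult.commute)
  qed
  then show ?thesis using assms(2) unfolding indep_processes_def by blast
qed

text \<open>Preimages of measurable sets lie in the generated \<sigma>-algebras, so independence is
  the product formula on rectangles, which determines the joint law.\<close>

lemma indep_processes_distr:
  assumes M: "prob_space M" and ind: "indep_processes M N1 I X N2 J Y"
    and X: "\<And>i. i \<in> I \<Longrightarrow> X i \<in> measurable M N1" and Y: "\<And>j. j \<in> J \<Longrightarrow> Y j \<in> measurable M N2"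
  shows "distr M (PiM I (\<lambda>_. N1)) (sample_path I X) \<Otimes>\<^sub>M distr M (PiM J (\<lambda>_. N2)) (sample_path J Y) =
    distr M (PiM I (\<lambda>_. N1) \<Otimes>\<^sub>M PiM J (\<lambda>_. N2)) (\<lambda>w. (sample_path I X w, sample_path J Y w))"
proof (rule pair_measure_eqI)
  interpret prob_space M by fact
  have mX [measurable]: "sample_path I X \<in> measurable M (PiM I (\<lambda>_. N1))"
    and [measurable]: "sample_path J Y \<in> measurable M (PiM J (\<lambda>_. N2))"
    by (rule sample_path_measurable, erule X Y)+
  let ?P = "PiM I (\<lambda>_. N1)" and ?Q = "PiM J (\<lambda>_. N2)"
  show "sigma_finite_measure (distr M ?P (sample_path I X))" "sigma_finite_measure (distr M ?Q (sample_path J Y))"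
    by (intro prob_space_imp_sigma_finite prob_space_distr; measurable)+
  fix A B assume "A \<in> sets (distr M ?P (sample_path I X))" "B \<in> sets (distr M ?Q (sample_path J Y))"
  then have A [measurable]: "A \<in> sets ?P" and B [measurable]: "B \<in> sets ?Q" by simp_all
  let ?A = "sample_path I X -` A \<inter> space M" and ?B = "sample_path J Y -` B \<inter> space M"
  have "?A \<in> sets (vimage_algebra (space M) (sample_path I X) ?P)"
    "?B \<in> sets (vimage_algebra (space M) (sample_path J Y) ?Q)"
    using in_vimage_algebra[OF A, of "sample_path I X" "space M"] in_vimage_algebra[OF B, of "sample_path J Y" "space M"]
    by simp_all
  then have "prob (?A \<inter> ?B) = prob ?A * prob ?B"
    using ind unfolding indep_processes_def indep_sets2_eq by blast
  then have "emeasure M (?A \<inter> ?B) = emeasure M ?A * emeasure M ?B"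
    by (simp add: emeasure_eq_measure ennreal_mult)
  also have "?A \<inter> ?B = (\<lambda>w. (sample_path I X w, sample_path J Y w)) -` (A \<times> B) \<inter> space M" by auto
  finally show "emeasure (distr M ?P (sample_path I X)) A * emeasure (distr M ?Q (sample_path J Y)) B =
      emeasure (distr M (?P \<Otimes>\<^sub>M ?Q) (\<lambda>w. (sample_path I X w, sample_path J Y w))) (A \<times> B)"
    by (simp add: emeasure_distr)
qed simp

text \<open>Conditioning on the first process: Fubini freezes its path and averages over the second
  alone. It is applied with the walk frozen and the medium averaged, and likewise with
  \<open>W\<close> frozen and \<open>Z\<close> averaged.\<close>

lemma indep_processes_integral:
  fixes g :: "('i \<Rightarrow> 'b) \<times> ('j \<Rightarrow> 'c) \<Rightarrow> real"
  assumes M: "prob_space M" and ind: "indep_processes M N1 I X N2 J Y"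
    and X: "\<And>i. i \<in> I \<Longrightarrow> X i \<in> measurable M N1" and Y: "\<And>j. j \<in> J \<Longrightarrow> Y j \<in> measurable M N2"
    and g [measurable]: "g \<in> borel_measurable (PiM I (\<lambda>_. N1) \<Otimes>\<^sub>M PiM J (\<lambda>_. N2))"
    and B: "\<And>x. \<bar>g x\<bar> \<le> B"
  shows "(\<integral>w. g (sample_path I X w, sample_path J Y w) \<partial>M) =
    (\<integral>w. (\<integral>w'. g (sample_path I X w, sample_path J Y w') \<partial>M) \<partial>M)"
proof -
  interpret prob_space M by fact
  have mX [measurable]: "sample_path I X \<in> measurable M (PiM I (\<lambda>_. N1))"
    and [measurable]: "sample_path J Y \<in> measurable M (PiM J (\<lambda>_. N2))"
    by (rule sample_path_measurable, erule X Y)+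
  let ?P = "PiM I (\<lambda>_. N1)" and ?Q = "PiM J (\<lambda>_. N2)"
  let ?DX = "distr M ?P (sample_path I X)" and ?DY = "distr M ?Q (sample_path J Y)"
  interpret DX: prob_space ?DX by (rule prob_space_distr) measurable
  interpret DY: prob_space ?DY by (rule prob_space_distr) measurable
  interpret D: pair_prob_space ?DX ?DY ..
  have int: "integrable (?DX \<Otimes>\<^sub>M ?DY) g"
    by (rule D.integrable_const_bound[where B=B]) (auto simp: B)
  have "(\<integral>w. g (sample_path I X w, sample_path J Y w) \<partial>M) = (\<integral>x. g x \<partial>(?DX \<Otimes>\<^sub>M ?DY))"
  proof -
    have "?DX \<Otimes>\<^sub>M ?DY = distr M (?P \<Otimes>\<^sub>M ?Q) (\<lambda>w. (sample_path I X w, sample_path J Y w))"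
      using indep_processes_distr[OF M ind X Y] by blast
    then show ?thesis by (simp add: integral_distr)
  qed
  also have "\<dots> = (\<integral>x. (\<integral>y. g (x, y) \<partial>?DY) \<partial>?DX)"
    by (rule D.integral_fst'[OF int, symmetric])
  also have "\<dots> = (\<integral>w. (\<integral>y. g (sample_path I X w, y) \<partial>?DY) \<partial>M)"
    by (rule integral_distr) measurable
  also have "\<dots> = (\<integral>w. (\<integral>w'. g (sample_path I X w, sample_path J Y w') \<partial>M) \<partial>M)"
  proof (rule Bochner_Integration.integral_cong[OF refl])
    fix w assume "w \<in> space M"
    then have [measurable]: "sample_path I X w \<in> space ?P"
      by (rule measurable_space[OF mX])
    show "(\<integral>y. g (sample_path I X w, y) \<partial>?DY) = (\<integral>w'. g (sample_path I X w, sample_path J Y w') \<partial>M)"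
      by (rule integral_distr) measurable
  qed
  finally show ?thesis .
qed

text \<open>Injectivity makes the singleton blocks \<open>{f i}\<close> disjoint. The reindexings
  needed are the two half-lines and the steps of the medium.\<close>

lemma iid_reindex:
  assumes M: "prob_space M" and X: "iid M N UNIV X" and inj: "inj_on f I"
  shows "iid M N I (\<lambda>i. X (f i))"
proof -
  interpret prob_space M by fact
  have ind: "indep_vars (\<lambda>_. N) X UNIV" using X by (simp add: iid_def)
  have "indep_vars (\<lambda>i. PiM {f i} (\<lambda>_. N)) (\<lambda>i w. restrict (\<lambda>j. X j w) {f i}) I"
    by (rule indep_vars_restrict[OF ind]) (use inj in \<open>auto simp: disjoint_family_on_def inj_on_def\<close>)
  then have "indep_vars (\<lambda>_. N) (\<lambda>i w. restrict (\<lambda>j. X j w) {f i} (f i)) I"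
    by (rule indep_vars_compose2[where Y="\<lambda>i x. x (f i)"]) (simp add: measurable_component_singleton)
  then have "indep_vars (\<lambda>_. N) (\<lambda>i. X (f i)) I" by simp
  moreover have "distr M N (X (f i)) = distr M N (X (f j))" for i j
    using X unfolding iid_def by blast
  ultimately show ?thesis unfolding iid_def by blast
qed

section \<open>The medium at deterministic positions\<close>

text \<open>At most one of the two sums is nonempty. Written as a difference, the medium becomes a
  function of two independent half-line families, with no case distinction on the sign of
  \<open>z\<close>.\<close>

lemma medium_split:
  "medium \<zeta> z w = (\<Sum>j=1..nat z. \<zeta> (int j) w) - (\<Sum>j=1..nat (- z). \<zeta> (- int j) w)"
proof (cases "0 \<le> z")
  case True
  have "(\<Sum>i=1..z. \<zeta> i w) = (\<Sum>j=1..nat z. \<zeta> (int j) w)"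
    by (rule sum.reindex_bij_witness[where i=int and j=nat]) auto
  then show ?thesis using True by (simp add: medium_def)
next
  case False
  have "(\<Sum>i=z..-1. \<zeta> i w) = (\<Sum>j=1..nat (- z). \<zeta> (- int j) w)"
    by (rule sum.reindex_bij_witness[where i="\<lambda>j. - int j" and j="\<lambda>i. nat (- i)"]) auto
  then show ?thesis using False by (simp add: medium_def)
qed

text \<open>Since \<open>\<zeta> 0\<close> is skipped, the step of the medium from \<open>i\<close> to \<open>i + 1\<close> is \<open>\<zeta> (medium_step i)\<close>.\<close>

definition medium_step :: "int \<Rightarrow> int" where
  "medium_step i = (if 0 \<le> i then i + 1 else i)"

lemma inj_medium_step: "inj_on medium_step A"
  by (rule inj_onI) (auto simp: medium_step_def split: if_splits)

text \<open>Together with injectivity of \<open>medium_step\<close> this gives stationary increments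
  also across the origin: every increment is a sum of as many distinct variables as there are unit
  steps.\<close>

lemma medium_diff:
  assumes "z' \<le> z"
  shows "medium \<zeta> z w - medium \<zeta> z' w = (\<Sum>i\<in>{z'..<z}. \<zeta> (medium_step i) w)"
  using assms
proof (induction z rule: int_ge_induct)
  case (step z)
  have "medium \<zeta> (z + 1) w - medium \<zeta> z w = \<zeta> (medium_step z) w"
  proof (cases "0 \<le> z")
    case True
    have "{1..z + 1} = insert (z + 1) {1..z}" using True by auto
    then show ?thesis using True by (simp add: medium_def medium_step_def)
  next
    case False
    have "{z..-1} = insert z {z + 1..-1}" using False by auto
    moreover have "medium \<zeta> (z + 1) w = - (\<Sum>i=z+1..-1. \<zeta> i w)"
      using False by (cases "z = -1") (auto simp: medium_def)
    ultimately show ?thesis using False by (simp add: medium_def medium_step_def)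
  qed
  moreover have "{z'..<z + 1} = insert z {z'..<z}" using step.hyps by auto
  ultimately show ?case using step.IH by simp
qed simp

lemma two_sided_split:
  assumes "levy_process N Zp" "levy_process N Zm" "w \<in> space N"
  shows "two_sided Zp Zm s w = Zp (max s 0) w - Zm (max (- s) 0) w"
  using levy_zero[OF assms(1,3)] levy_zero[OF assms(2,3)] by (simp add: two_sided_def max_def)

locale random_medium = prob_space M
  for M :: "'a measure" +
  fixes \<zeta> :: "int \<Rightarrow> 'a \<Rightarrow> real" and \<beta> :: real and P :: "real measure"
  assumes iid: "iid M borel UNIV \<zeta>"
    and attracted: "normally_attracted M (\<lambda>i. \<zeta> (int i)) \<beta> P"
    and index_pos: "0 < \<beta>"
    and limit_distr: "real_distribution P"
    and char_nonzero: "char P \<theta> \<noteq> 0"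
begin

lemma indep: "indep_vars (\<lambda>_. borel) \<zeta> UNIV"
  using iid unfolding iid_def by blast

lemma rv [measurable]: "random_variable borel (\<zeta> i)"
  using indep unfolding indep_vars_def by blast

lemma same_distr: "distr M borel (\<zeta> i) = distr M borel (\<zeta> j)"
  using iid unfolding iid_def by blast

lemma rv_medium [measurable]: "random_variable borel (medium \<zeta> z)"
  unfolding medium_def[abs_def] by measurable

lemma iid_comp: "inj_on f I \<Longrightarrow> iid M borel I (\<lambda>i. \<zeta> (f i))"
  by (rule iid_reindex[OF prob_space_axioms iid])

lemma indep_comp: "inj_on f I \<Longrightarrow> indep_vars (\<lambda>_. borel) (\<lambda>i. \<zeta> (f i)) I"
  using iid_comp unfolding iid_def by blast

lemma distr_sum_comp:
  assumes "inj_on f D" "inj_on g E" "card D = card E"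
  shows "distr M borel (\<lambda>w. \<Sum>i\<in>D. \<zeta> (f i) w) = distr M borel (\<lambda>w. \<Sum>i\<in>E. \<zeta> (g i) w)"
  by (rule distr_iid_sum_cong[where Q="distr M borel (\<zeta> 0)"])
    (intro prob_space_axioms indep_comp assms same_distr)+

lemma positive_sums: "attracted_sums M (\<lambda>i. \<zeta> (int i)) \<beta> P"
proof (intro attracted_sums.intro attracted_sums_axioms.intro)
  show "iid M borel {1..} (\<lambda>i. \<zeta> (int i))" by (rule iid_comp) (simp add: inj_on_def)
qed (rule prob_space_axioms attracted index_pos limit_distr char_nonzero)+

lemma negative_sums: "attracted_sums M (\<lambda>i. \<zeta> (- int i)) \<beta> P"
proof (intro attracted_sums.intro attracted_sums_axioms.intro)
  show "iid M borel {1..} (\<lambda>i. \<zeta> (- int i))" by (rule iid_comp) (simp add: inj_on_def)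
  have "distr M borel (\<lambda>w. (\<Sum>i=1..n. \<zeta> (- int i) w) / real n powr (1 / \<beta>)) =
      distr M borel (\<lambda>w. (\<Sum>i=1..n. \<zeta> (int i) w) / real n powr (1 / \<beta>))" for n
  proof -
    have "distr M borel (\<lambda>w. \<Sum>i=1..n. \<zeta> (- int i) w) = distr M borel (\<lambda>w. \<Sum>i=1..n. \<zeta> (int i) w)"
      by (rule distr_sum_comp) (simp_all add: inj_on_def)
    from distr_scale_cong[OF _ _ this, of "1 / real n powr (1 / \<beta>)"] show ?thesis by simp
  qed
  then show "normally_attracted M (\<lambda>i. \<zeta> (- int i)) \<beta> P"
    using attracted by (simp add: normally_attracted_def)
qed (rule prob_space_axioms index_pos limit_distr char_nonzero)+

text \<open>By stationarity the increment is, up to sign, distributed like a sum of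
  \<open>\<bar>z - z'\<bar>\<close> variables; evenness of \<open>\<phi>\<close> absorbs the
  sign.\<close>

lemma medium_increment_integral:
  assumes cs: "coupled_sums M (\<lambda>i. \<zeta> (int i)) \<beta> P \<Omega> Y Y_lim" and c: "0 \<le> c"
    and \<phi> [measurable]: "\<phi> \<in> borel_measurable borel" and even: "\<And>x. \<phi> (- x) = \<phi> x"
  shows "(\<integral>w. \<phi> ((medium \<zeta> z w - medium \<zeta> z' w) / c powr (1 / \<beta>)) \<partial>M) =
    (\<integral>x. (\<phi> (coupled_sums.scaled \<beta> Y c (nat \<bar>z - z'\<bar>) x) :: real) \<partial>\<Omega>)"
proof -
  interpret coupled_sums M "\<lambda>i. \<zeta> (int i)" \<beta> P \<Omega> Y Y_lim by fact
  have ordered: "(\<integral>w. \<phi> ((medium \<zeta> z w - medium \<zeta> z' w) / c powr (1 / \<beta>)) \<partial>M) =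
    (\<integral>x. \<phi> (scaled c (nat (z - z')) x) \<partial>\<Omega>)" if le: "z' \<le> z" for z z'
  proof (rule integral_cong_distr[where S=borel and h=\<phi> and G="scaled c (nat (z - z'))"
        and F="\<lambda>w. (medium \<zeta> z w - medium \<zeta> z' w) / c powr (1 / \<beta>)"])
    have "distr M borel (\<lambda>w. \<Sum>i\<in>{z'..<z}. \<zeta> (medium_step i) w) =
        distr M borel (\<lambda>w. \<Sum>i=1..nat (z - z'). \<zeta> (int i) w)"
      by (rule distr_sum_comp) (simp_all add: inj_medium_step)
    from distr_scale_cong[OF _ _ this, of "1 / c powr (1 / \<beta>)"]
    have "distr M borel (\<lambda>w. (medium \<zeta> z w - medium \<zeta> z' w) / c powr (1 / \<beta>)) =
        distr M borel (\<lambda>w. (\<Sum>i=1..nat (z - z'). \<zeta> (int i) w) / c powr (1 / \<beta>))"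
      by (simp add: medium_diff[OF le])
    also have "\<dots> = distr \<Omega> borel (scaled c (nat (z - z')))"
      using distr_scaled[of "{1..nat (z - z')}" c] c by simp
    finally show "distr M borel (\<lambda>w. (medium \<zeta> z w - medium \<zeta> z' w) / c powr (1 / \<beta>)) =
        distr \<Omega> borel (scaled c (nat (z - z')))" .
  qed measurable
  show ?thesis
  proof (cases "z' \<le> z")
    case True
    then show ?thesis using ordered[OF True] by simp
  next
    case False
    have "\<phi> ((medium \<zeta> z w - medium \<zeta> z' w) / c powr (1 / \<beta>)) = \<phi> ((medium \<zeta> z' w - medium \<zeta> z w) / c powr (1 / \<beta>))" for w
      using even[of "(medium \<zeta> z w - medium \<zeta> z' w) / c powr (1 / \<beta>)"] by (simp flip: divide_minus_left)
    moreover have "\<bar>z - z'\<bar> = z' - z" "z \<le> z'" using False by auto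
    ultimately show ?thesis using ordered[of z z'] by simp
  qed
qed

text \<open>The two positions are o(c) sites apart, so this is \<open>scaled_tendsto\<close> at time
  0: the normalised increment tends to 0 in the coupling, even if the number of sites stays
  bounded.\<close>

lemma medium_increment_tendsto:
  assumes c: "filterlim c at_top sequentially" "\<And>n. 0 \<le> c n"
    and z: "(\<lambda>n. real_of_int (z n - z' n) / c n) \<longlonglongrightarrow> 0"
    and \<phi>: "continuous_on UNIV \<phi>" and even: "\<And>x. \<phi> (- x) = \<phi> x" and B: "\<And>x. \<bar>\<phi> x\<bar> \<le> B"
  shows "(\<lambda>n. \<integral>w. \<phi> ((medium \<zeta> (z n) w - medium \<zeta> (z' n) w) / c n powr (1 / \<beta>)) \<partial>M) \<longlonglongrightarrow> (\<phi> 0 :: real)"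
proof -
  obtain \<Omega> Y Y_lim where cs: "coupled_sums M (\<lambda>i. \<zeta> (int i)) \<beta> P \<Omega> Y Y_lim"
    using attracted_sums.coupled_sums_exists[OF positive_sums] .
  interpret coupled_sums M "\<lambda>i. \<zeta> (int i)" \<beta> P \<Omega> Y Y_lim by fact
  have [measurable]: "\<phi> \<in> borel_measurable borel" using \<phi> by (rule borel_measurable_continuous_onI)
  have "(\<lambda>n. \<bar>real_of_int (z n - z' n) / c n\<bar>) \<longlonglongrightarrow> \<bar>0\<bar>" by (intro tendsto_rabs z)
  then have d: "(\<lambda>n. real (nat \<bar>z n - z' n\<bar>) / c n) \<longlonglongrightarrow> 0"
    using c(2) by (simp add: abs_divide)
  have lim: "(\<lambda>n. \<phi> (scaled (c n) (nat \<bar>z n - z' n\<bar>) x)) \<longlonglongrightarrow> \<phi> 0" if "x \<in> space \<Omega>" for x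
  proof (rule isCont_tendsto_compose[of _ \<phi>])
    show "isCont \<phi> 0" using \<phi> by (simp add: continuous_on_eq_continuous_at)
    show "(\<lambda>n. scaled (c n) (nat \<bar>z n - z' n\<bar>) x) \<longlonglongrightarrow> 0"
      using scaled_tendsto[OF that c(1) d] by simp
  qed
  have "(\<lambda>n. \<integral>x. \<phi> (scaled (c n) (nat \<bar>z n - z' n\<bar>) x) \<partial>\<Omega>) \<longlonglongrightarrow> (\<integral>x. \<phi> 0 \<partial>\<Omega>)"
    by (rule integral_dominated_convergence[where w="\<lambda>_. B"]) (auto simp: B lim)
  moreover have "(\<integral>w. \<phi> ((medium \<zeta> (z n) w - medium \<zeta> (z' n) w) / c n powr (1 / \<beta>)) \<partial>M) =
      (\<integral>x. \<phi> (scaled (c n) (nat \<bar>z n - z' n\<bar>) x) \<partial>\<Omega>)" for n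
    by (rule medium_increment_integral[where \<phi>=\<phi>, OF cs c(2) _ even]) measurable
  ultimately show ?thesis by (simp add: \<Omega>.prob_space)
qed

end

section \<open>Convergence of the medium to the two-sided Levy process\<close>

locale medium_limit = random_medium M \<zeta> \<beta> P + N: prob_space N
  for M :: "'a measure" and \<zeta> \<beta> P and N :: "'b measure" +
  fixes Zp Zm :: "real \<Rightarrow> 'b \<Rightarrow> real"
  assumes levy: "levy_process N Zp" "levy_process N Zm"
    and levy_one: "distr N borel (Zp 1) = P" "distr N borel (Zm 1) = P"
    and levy_indep: "indep_processes N borel {0..} Zp borel {0..} Zm"
begin

text \<open>The position is \<open>c n * x i\<close> rounded towards 0, written so that each
  half-line sees a nonnegative time, \<open>max (x i) 0\<close> or \<open>max (- x i) 0\<close>.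
  Each half is coupled on its own space, and the product of the two spaces carries both couplings
  independently.\<close>

lemma medium_fixed_tendsto:
  fixes x :: "'m::finite \<Rightarrow> real" and f :: "real ^ 'm \<Rightarrow> real"
  assumes c: "filterlim c at_top sequentially" "\<And>n. 0 \<le> c n"
    and f: "continuous_on UNIV f" and B: "\<And>y. \<bar>f y\<bar> \<le> B"
  shows "(\<lambda>n. \<integral>w. f (\<chi> i. medium \<zeta> (\<lfloor>c n * max (x i) 0\<rfloor> - \<lfloor>c n * max (- x i) 0\<rfloor>) w / c n powr (1 / \<beta>)) \<partial>M)
    \<longlonglongrightarrow> (\<integral>w. f (\<chi> i. two_sided Zp Zm (x i) w) \<partial>N)"
proof -
  let ?p = "\<lambda>i. max (x i) 0" and ?q = "\<lambda>i. max (- x i) 0"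
  let ?S = "PiM (UNIV :: 'm set) (\<lambda>_. borel :: real measure)"
  obtain \<Omega>p Yp Yp_lim where cp: "coupled_sums M (\<lambda>i. \<zeta> (int i)) \<beta> P \<Omega>p Yp Yp_lim"
    using attracted_sums.coupled_sums_exists[OF positive_sums] .
  obtain \<Omega>m Ym Ym_lim where cm: "coupled_sums M (\<lambda>i. \<zeta> (- int i)) \<beta> P \<Omega>m Ym Ym_lim"
    using attracted_sums.coupled_sums_exists[OF negative_sums] .
  define Fp where "Fp n w i = (\<Sum>j=1..nat \<lfloor>c n * ?p i\<rfloor>. \<zeta> (int j) w) / c n powr (1 / \<beta>)" for n w i
  define Fm where "Fm n w i = (\<Sum>j=1..nat \<lfloor>c n * ?q i\<rfloor>. \<zeta> (- int j) w) / c n powr (1 / \<beta>)" for n w i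
  define Gp where "Gp w i = Zp (?p i) w" for w i
  define Gm where "Gm w i = Zm (?q i) w" for w i
  obtain \<Omega>1 :: "(nat \<Rightarrow> real) measure" and U U' where U: "prob_space \<Omega>1"
    "\<And>n. U n \<in> measurable \<Omega>1 ?S" "U' \<in> measurable \<Omega>1 ?S"
    "\<And>n. distr M ?S (Fp n) = distr \<Omega>1 ?S (U n)" "distr N ?S Gp = distr \<Omega>1 ?S U'"
    "\<And>\<omega> i. \<omega> \<in> space \<Omega>1 \<Longrightarrow> (\<lambda>n. U n \<omega> i) \<longlonglongrightarrow> U' \<omega> i"
    unfolding Fp_def[abs_def] Gp_def[abs_def]
    by (rule coupled_sums.fdd_coupling[OF cp c _ N.prob_space_axioms levy(1) levy_one(1), of ?p]) auto
  obtain \<Omega>2 :: "(nat \<Rightarrow> real) measure" and V V' where V: "prob_space \<Omega>2"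
    "\<And>n. V n \<in> measurable \<Omega>2 ?S" "V' \<in> measurable \<Omega>2 ?S"
    "\<And>n. distr M ?S (Fm n) = distr \<Omega>2 ?S (V n)" "distr N ?S Gm = distr \<Omega>2 ?S V'"
    "\<And>\<omega> i. \<omega> \<in> space \<Omega>2 \<Longrightarrow> (\<lambda>n. V n \<omega> i) \<longlonglongrightarrow> V' \<omega> i"
    unfolding Fm_def[abs_def] Gm_def[abs_def]
    by (rule coupled_sums.fdd_coupling[OF cm c _ N.prob_space_axioms levy(2) levy_one(2), of ?q]) auto
  interpret \<Omega>1: prob_space \<Omega>1 by fact
  interpret \<Omega>2: prob_space \<Omega>2 by fact
  interpret \<Omega>12: pair_prob_space \<Omega>1 \<Omega>2 ..
  note [measurable] = U(2,3) V(2,3)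
  have [measurable]: "f \<in> borel_measurable borel" using f by (rule borel_measurable_continuous_onI)
  have Fp [measurable]: "Fp n \<in> measurable M ?S" for n
    unfolding Fp_def[abs_def] by (rule measurable_PiM_UNIV_I) measurable
  have Fm [measurable]: "Fm n \<in> measurable M ?S" for n
    unfolding Fm_def[abs_def] by (rule measurable_PiM_UNIV_I) measurable
  have Gp [measurable]: "Gp \<in> measurable N ?S"
    unfolding Gp_def[abs_def] by (rule measurable_PiM_UNIV_I) (simp add: levy_rv[OF levy(1)])
  have Gm [measurable]: "Gm \<in> measurable N ?S"
    unfolding Gm_def[abs_def] by (rule measurable_PiM_UNIV_I) (simp add: levy_rv[OF levy(2)])
  define h where "h ab = f (\<chi> i. fst ab i - snd ab i)" for ab :: "('m \<Rightarrow> real) \<times> ('m \<Rightarrow> real)"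
  have h [measurable]: "h \<in> borel_measurable (?S \<Otimes>\<^sub>M ?S)"
  proof -
    have "(\<lambda>ab :: ('m \<Rightarrow> real) \<times> ('m \<Rightarrow> real). \<chi> i. fst ab i - snd ab i) \<in> borel_measurable (?S \<Otimes>\<^sub>M ?S)"
      by (rule borel_measurable_vec_lambdaI) measurable
    then show ?thesis unfolding h_def[abs_def] by measurable
  qed
  have hB: "\<bar>h ab\<bar> \<le> B" for ab by (simp add: h_def B)
  \<comment> \<open>Once the two components are independent, equality of the marginal laws with
    those of the couplings forces equality of the joint laws.\<close>
  have joint: "distr M' (?S \<Otimes>\<^sub>M ?S) (\<lambda>w. (A w, A' w)) = distr (\<Omega>1 \<Otimes>\<^sub>M \<Omega>2) (?S \<Otimes>\<^sub>M ?S) (\<lambda>(a, b). (C a, C' b))"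
    if "distr M' ?S A \<Otimes>\<^sub>M distr M' ?S A' = distr M' (?S \<Otimes>\<^sub>M ?S) (\<lambda>w. (A w, A' w))"
      "distr M' ?S A = distr \<Omega>1 ?S C" "distr M' ?S A' = distr \<Omega>2 ?S C'"
      "C \<in> measurable \<Omega>1 ?S" and C': "C' \<in> measurable \<Omega>2 ?S"
    for M' :: "'z measure" and A A' C C'
    using pair_measure_distr[OF that(4) C' prob_space_imp_sigma_finite[OF \<Omega>2.prob_space_distr[OF C']]] that(1-3)
    by simp
  have M_joint: "distr M (?S \<Otimes>\<^sub>M ?S) (\<lambda>w. (Fp n w, Fm n w)) =
      distr (\<Omega>1 \<Otimes>\<^sub>M \<Omega>2) (?S \<Otimes>\<^sub>M ?S) (\<lambda>(a, b). (U n a, V n b))" for n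
  proof (rule joint[OF _ U(4) V(4) U(2) V(2)])
    \<comment> \<open>The two halves of the medium read disjoint sets of sites, neither of which
      contains 0.\<close>
    let ?A = "{1..} :: int set" and ?B = "{..-1} :: int set"
    have ind: "indep_var (PiM ?A (\<lambda>_. borel)) (\<lambda>w. restrict (\<lambda>i. \<zeta> i w) ?A) (PiM ?B (\<lambda>_. borel)) (\<lambda>w. restrict (\<lambda>i. \<zeta> i w) ?B)"
      by (rule indep_var_restrict[OF indep]) auto
    define Rp where "Rp z i = (\<Sum>j=1..nat \<lfloor>c n * ?p i\<rfloor>. z (int j)) / c n powr (1 / \<beta>)" for z :: "int \<Rightarrow> real" and i
    define Rm where "Rm z i = (\<Sum>j=1..nat \<lfloor>c n * ?q i\<rfloor>. z (- int j)) / c n powr (1 / \<beta>)" for z :: "int \<Rightarrow> real" and i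
    have "Rp \<in> measurable (PiM ?A (\<lambda>_. borel)) ?S"
      unfolding Rp_def[abs_def]
      by (intro measurable_PiM_UNIV_I borel_measurable_divide borel_measurable_sum measurable_component_singleton) auto
    moreover have "Rm \<in> measurable (PiM ?B (\<lambda>_. borel)) ?S"
      unfolding Rm_def[abs_def]
      by (intro measurable_PiM_UNIV_I borel_measurable_divide borel_measurable_sum measurable_component_singleton) auto
    ultimately have "indep_var ?S (Rp \<circ> (\<lambda>w. restrict (\<lambda>i. \<zeta> i w) ?A)) ?S (Rm \<circ> (\<lambda>w. restrict (\<lambda>i. \<zeta> i w) ?B))"
      by (rule indep_var_compose[OF ind])
    moreover have "Rp \<circ> (\<lambda>w. restrict (\<lambda>i. \<zeta> i w) ?A) = Fp n"
      by (intro ext) (simp add: Rp_def Fp_def)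
    moreover have "Rm \<circ> (\<lambda>w. restrict (\<lambda>i. \<zeta> i w) ?B) = Fm n"
      by (intro ext) (simp add: Rm_def Fm_def)
    ultimately show "distr M ?S (Fp n) \<Otimes>\<^sub>M distr M ?S (Fm n) = distr M (?S \<Otimes>\<^sub>M ?S) (\<lambda>w. (Fp n w, Fm n w))"
      by (simp add: indep_var_distribution_eq)
  qed
  have N_joint: "distr N (?S \<Otimes>\<^sub>M ?S) (\<lambda>w. (Gp w, Gm w)) =
      distr (\<Omega>1 \<Otimes>\<^sub>M \<Omega>2) (?S \<Otimes>\<^sub>M ?S) (\<lambda>(a, b). (U' a, V' b))"
  proof (rule joint[OF _ U(5) V(5) U(3) V(3)])
    let ?T = "PiM {0 :: real..} (\<lambda>_. borel :: real measure)"
    let ?Pp = "sample_path {0..} Zp" and ?Pm = "sample_path {0..} Zm"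
    \<comment> \<open>Independence of the limit is given for whole sample paths; it descends to the
      finitely many times through these evaluations.\<close>
    define Rp where "Rp z i = z (?p i)" for z :: "real \<Rightarrow> real" and i
    define Rm where "Rm z i = z (?q i)" for z :: "real \<Rightarrow> real" and i
    have [measurable]: "?Pp \<in> measurable N ?T" "?Pm \<in> measurable N ?T"
      by (rule sample_path_measurable, simp add: levy_rv levy)+
    have Rp [measurable]: "Rp \<in> measurable ?T ?S"
      unfolding Rp_def[abs_def] by (intro measurable_PiM_UNIV_I measurable_component_singleton) simp
    have Rm [measurable]: "Rm \<in> measurable ?T ?S"
      unfolding Rm_def[abs_def] by (intro measurable_PiM_UNIV_I measurable_component_singleton) simp
    have G: "Gp = (\<lambda>w. Rp (?Pp w))" "Gm = (\<lambda>w. Rm (?Pm w))"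
      by (simp_all add: fun_eq_iff Gp_def Gm_def Rp_def Rm_def sample_path_def)
    have dist: "distr N ?T ?Pp \<Otimes>\<^sub>M distr N ?T ?Pm = distr N (?T \<Otimes>\<^sub>M ?T) (\<lambda>w. (?Pp w, ?Pm w))"
      by (rule indep_processes_distr[OF N.prob_space_axioms levy_indep]) (simp_all add: levy_rv levy)
    have sf: "sigma_finite_measure (distr (distr N ?T ?Pm) ?S Rm)"
      by (intro prob_space_imp_sigma_finite prob_space.prob_space_distr N.prob_space_distr) measurable
    have "distr N ?S Gp \<Otimes>\<^sub>M distr N ?S Gm = distr (distr N ?T ?Pp) ?S Rp \<Otimes>\<^sub>M distr (distr N ?T ?Pm) ?S Rm"
      unfolding G by (simp add: distr_distr comp_def)
    also have "\<dots> = distr (distr N ?T ?Pp \<Otimes>\<^sub>M distr N ?T ?Pm) (?S \<Otimes>\<^sub>M ?S) (\<lambda>(x, y). (Rp x, Rm y))"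
      by (rule pair_measure_distr[OF _ _ sf]) measurable
    also have "\<dots> = distr N (?S \<Otimes>\<^sub>M ?S) (\<lambda>w. (Gp w, Gm w))"
      unfolding dist G by (subst distr_distr) (simp_all add: comp_def)
    finally show "distr N ?S Gp \<Otimes>\<^sub>M distr N ?S Gm = distr N (?S \<Otimes>\<^sub>M ?S) (\<lambda>w. (Gp w, Gm w))" .
  qed
  have M_eq: "(\<integral>w. f (\<chi> i. medium \<zeta> (\<lfloor>c n * ?p i\<rfloor> - \<lfloor>c n * ?q i\<rfloor>) w / c n powr (1 / \<beta>)) \<partial>M) =
      (\<integral>\<omega>. h (case \<omega> of (a, b) \<Rightarrow> (U n a, V n b)) \<partial>(\<Omega>1 \<Otimes>\<^sub>M \<Omega>2))" for n
  proof -
    have "medium \<zeta> (\<lfloor>c n * ?p i\<rfloor> - \<lfloor>c n * ?q i\<rfloor>) w / c n powr (1 / \<beta>) = Fp n w i - Fm n w i" for w i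
    proof -
      have "0 \<le> \<lfloor>c n * ?p i\<rfloor>" "0 \<le> \<lfloor>c n * ?q i\<rfloor>" using c(2)[of n] by simp_all
      moreover have "?p i = 0 \<or> ?q i = 0" by (auto simp: max_def)
      ultimately show ?thesis
        unfolding Fp_def Fm_def medium_split by (auto simp: diff_divide_distrib)
    qed
    then have "(\<integral>w. f (\<chi> i. medium \<zeta> (\<lfloor>c n * ?p i\<rfloor> - \<lfloor>c n * ?q i\<rfloor>) w / c n powr (1 / \<beta>)) \<partial>M) =
        (\<integral>w. h (Fp n w, Fm n w) \<partial>M)"
      by (simp add: h_def)
    also have "\<dots> = (\<integral>\<omega>. h (case \<omega> of (a, b) \<Rightarrow> (U n a, V n b)) \<partial>(\<Omega>1 \<Otimes>\<^sub>M \<Omega>2))"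
      by (rule integral_cong_distr[OF _ _ M_joint h]) measurable
    finally show ?thesis .
  qed
  have N_eq: "(\<integral>w. f (\<chi> i. two_sided Zp Zm (x i) w) \<partial>N) =
      (\<integral>\<omega>. h (case \<omega> of (a, b) \<Rightarrow> (U' a, V' b)) \<partial>(\<Omega>1 \<Otimes>\<^sub>M \<Omega>2))"
  proof -
    have "(\<integral>w. f (\<chi> i. two_sided Zp Zm (x i) w) \<partial>N) = (\<integral>w. h (Gp w, Gm w) \<partial>N)"
      by (rule Bochner_Integration.integral_cong[OF refl])
        (simp add: h_def Gp_def Gm_def two_sided_split[OF levy])
    also have "\<dots> = (\<integral>\<omega>. h (case \<omega> of (a, b) \<Rightarrow> (U' a, V' b)) \<partial>(\<Omega>1 \<Otimes>\<^sub>M \<Omega>2))"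
      by (rule integral_cong_distr[OF _ _ N_joint h]) measurable
    finally show ?thesis .
  qed
  show ?thesis
    unfolding M_eq N_eq
  proof (rule integral_dominated_convergence[where w="\<lambda>_. B"])
    show "AE \<omega> in \<Omega>1 \<Otimes>\<^sub>M \<Omega>2. (\<lambda>n. h (case \<omega> of (a, b) \<Rightarrow> (U n a, V n b))) \<longlonglongrightarrow> h (case \<omega> of (a, b) \<Rightarrow> (U' a, V' b))"
    proof (rule AE_I2)
      fix \<omega> assume "\<omega> \<in> space (\<Omega>1 \<Otimes>\<^sub>M \<Omega>2)"
      then obtain a b where \<omega>: "\<omega> = (a, b)" "a \<in> space \<Omega>1" "b \<in> space \<Omega>2"
        by (auto simp: space_pair_measure)
      have "(\<lambda>n. \<chi> i. U n a i - V n b i) \<longlonglongrightarrow> (\<chi> i. U' a i - V' b i)"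
        by (intro tendsto_vec_lambda tendsto_diff U(6)[OF \<omega>(2)] V(6)[OF \<omega>(3)])
      then have "(\<lambda>n. f (\<chi> i. U n a i - V n b i)) \<longlonglongrightarrow> f (\<chi> i. U' a i - V' b i)"
        using f by (intro isCont_tendsto_compose[of _ f]) (simp_all add: continuous_on_eq_continuous_at)
      then show "(\<lambda>n. h (case \<omega> of (a, b) \<Rightarrow> (U n a, V n b))) \<longlonglongrightarrow> h (case \<omega> of (a, b) \<Rightarrow> (U' a, V' b))"
        by (simp add: \<omega>(1) h_def)
    qed
  qed (simp_all add: hB)
qed

lemma medium_moving_tendsto:
  fixes x :: "'m::finite \<Rightarrow> real" and f :: "real ^ 'm \<Rightarrow> real" and z :: "nat \<Rightarrow> 'm \<Rightarrow> int"
  assumes c: "filterlim c at_top sequentially" "\<And>n. 0 \<le> c n"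
    and z: "\<And>i. (\<lambda>n. real_of_int (z n i) / c n) \<longlonglongrightarrow> x i"
    and f: "K-lipschitz_on UNIV f" and B: "\<And>y. \<bar>f y\<bar> \<le> B"
  shows "(\<lambda>n. \<integral>w. f (\<chi> i. medium \<zeta> (z n i) w / c n powr (1 / \<beta>)) \<partial>M)
    \<longlonglongrightarrow> (\<integral>w. f (\<chi> i. two_sided Zp Zm (x i) w) \<partial>N)"
proof -
  have K: "0 \<le> K" and cont: "continuous_on UNIV f"
    using f by (auto intro: lipschitz_on_nonneg lipschitz_on_continuous_on)
  have [measurable]: "f \<in> borel_measurable borel" using cont by (rule borel_measurable_continuous_onI)
  have B0: "0 \<le> B" using B[of 0] by linarith
  define z' where "z' n i = \<lfloor>c n * max (x i) 0\<rfloor> - \<lfloor>c n * max (- x i) 0\<rfloor>" for n i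
  define G where "G z n w = f (\<chi> i. medium \<zeta> (z n i) w / c n powr (1 / \<beta>))"
    for z :: "nat \<Rightarrow> 'm \<Rightarrow> int" and n w
  have [measurable]: "random_variable borel (G z n)" for z n
  proof -
    have "random_variable borel (\<lambda>w. \<chi> i. medium \<zeta> (z n i) w / c n powr (1 / \<beta>))"
      by (rule borel_measurable_vec_lambdaI) measurable
    then show ?thesis unfolding G_def[abs_def] by measurable
  qed
  have int: "integrable M (G z n)" for z n
    by (rule integrable_const_bound[where B=B]) (auto simp: G_def B)
  \<comment> \<open>A bound for the change of \<open>f\<close> under a shift \<open>u\<close> of one
    coordinate: \<open>K * \<bar>u\<bar>\<close> from the Lipschitz condition, \<open>2 * B\<close>
    from boundedness. The truncation is essential, because increments of the medium need not be
    integrable.\<close>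
  define \<phi> where "\<phi> u = min (2 * B) (K * \<bar>u\<bar>)" for u :: real
  have \<phi>_nonneg: "0 \<le> \<phi> u" for u using B0 K by (simp add: \<phi>_def)
  have \<phi>_le: "\<phi> u \<le> 2 * B" for u by (simp add: \<phi>_def)
  have \<phi>_cont: "continuous_on UNIV \<phi>" unfolding \<phi>_def[abs_def] by (intro continuous_intros)
  have [measurable]: "\<phi> \<in> borel_measurable borel" using \<phi>_cont by (rule borel_measurable_continuous_onI)
  define d where "d n i w = (medium \<zeta> (z n i) w - medium \<zeta> (z' n i) w) / c n powr (1 / \<beta>)" for n i w
  have [measurable]: "random_variable borel (d n i)" for n i unfolding d_def[abs_def] by measurable
  have int_d: "integrable M (\<lambda>w. \<phi> (d n i w))" for n i
    by (rule integrable_const_bound[where B="2 * B"]) (auto simp: \<phi>_le \<phi>_nonneg abs_of_nonneg)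
  have close: "\<bar>G z n w - G z' n w\<bar> \<le> (\<Sum>i\<in>UNIV. \<phi> (d n i w))" for n w
  proof -
    let ?u = "(\<chi> i. medium \<zeta> (z n i) w / c n powr (1 / \<beta>)) :: real ^ 'm"
    let ?v = "(\<chi> i. medium \<zeta> (z' n i) w / c n powr (1 / \<beta>)) :: real ^ 'm"
    have "\<bar>G z n w - G z' n w\<bar> \<le> K * dist ?u ?v"
      using lipschitz_onD[OF f, of ?u ?v] by (simp add: G_def dist_real_def)
    also have "\<dots> \<le> K * (\<Sum>i\<in>UNIV. \<bar>d n i w\<bar>)"
      using norm_le_l1_cart[of "?u - ?v"] K
      by (intro mult_left_mono) (simp_all add: dist_norm d_def diff_divide_distrib)
    finally have lip: "\<bar>G z n w - G z' n w\<bar> \<le> (\<Sum>i\<in>UNIV. K * \<bar>d n i w\<bar>)"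
      by (simp add: sum_distrib_left)
    show ?thesis
    \<comment> \<open>If one coordinate reaches the cap, its term alone dominates any difference of
      values of \<open>f\<close>. Otherwise no term is truncated and the Lipschitz bound in the l1
      norm applies.\<close>
    proof (cases "\<exists>i. 2 * B \<le> K * \<bar>d n i w\<bar>")
      case True
      then obtain i where "2 * B \<le> K * \<bar>d n i w\<bar>" by blast
      then have "2 * B \<le> \<phi> (d n i w)" by (simp add: \<phi>_def)
      also have "\<dots> \<le> (\<Sum>i\<in>UNIV. \<phi> (d n i w))" by (rule member_le_sum) (simp_all add: \<phi>_nonneg)
      finally show ?thesis using B[of ?u] B[of ?v] unfolding G_def by linarith
    next
      case False
      then have "\<phi> (d n i w) = K * \<bar>d n i w\<bar>" for i
        unfolding \<phi>_def by (intro min_absorb2) (auto simp: not_le intro: less_imp_le)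
      then show ?thesis using lip by simp
    qed
  qed
  have "(\<lambda>n. (\<integral>w. G z n w \<partial>M) - (\<integral>w. G z' n w \<partial>M)) \<longlonglongrightarrow> 0"
  proof (rule Lim_null_comparison)
    show "\<forall>\<^sub>F n in sequentially. norm ((\<integral>w. G z n w \<partial>M) - (\<integral>w. G z' n w \<partial>M)) \<le> (\<Sum>i\<in>UNIV. \<integral>w. \<phi> (d n i w) \<partial>M)"
    proof (rule always_eventually, rule allI)
      fix n
      have "norm ((\<integral>w. G z n w \<partial>M) - (\<integral>w. G z' n w \<partial>M)) = \<bar>\<integral>w. G z n w - G z' n w \<partial>M\<bar>"
        by (simp add: int)
      also have "\<dots> \<le> (\<integral>w. \<bar>G z n w - G z' n w\<bar> \<partial>M)" by (rule integral_abs_bound)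
      also have "\<dots> \<le> (\<integral>w. (\<Sum>i\<in>UNIV. \<phi> (d n i w)) \<partial>M)"
        by (intro integral_mono integrable_abs Bochner_Integration.integrable_diff
            Bochner_Integration.integrable_sum int int_d close)
      also have "\<dots> = (\<Sum>i\<in>UNIV. \<integral>w. \<phi> (d n i w) \<partial>M)"
        by (rule Bochner_Integration.integral_sum) (rule int_d)
      finally show "norm ((\<integral>w. G z n w \<partial>M) - (\<integral>w. G z' n w \<partial>M)) \<le> (\<Sum>i\<in>UNIV. \<integral>w. \<phi> (d n i w) \<partial>M)" .
    qed
    have "(\<lambda>n. \<integral>w. \<phi> (d n i w) \<partial>M) \<longlonglongrightarrow> \<phi> 0" for i
      unfolding d_def
    proof (rule medium_increment_tendsto[OF c _ \<phi>_cont])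
      have "(\<lambda>n. real_of_int \<lfloor>c n * max (x i) 0\<rfloor> / c n - real_of_int \<lfloor>c n * max (- x i) 0\<rfloor> / c n)
          \<longlonglongrightarrow> max (x i) 0 - max (- x i) 0"
        by (intro tendsto_diff floor_ratio_tendsto tendsto_const c)
      moreover have "max (x i) 0 - max (- x i) 0 = x i" by simp
      ultimately have "(\<lambda>n. real_of_int (z' n i) / c n) \<longlonglongrightarrow> x i"
        by (simp only: z'_def of_int_diff diff_divide_distrib)
      from tendsto_diff[OF z[of i] this]
      show "(\<lambda>n. real_of_int (z n i - z' n i) / c n) \<longlonglongrightarrow> 0"
        by (simp add: diff_divide_distrib)
      show "\<phi> (- u) = \<phi> u" for u by (simp add: \<phi>_def)
      show "\<bar>\<phi> u\<bar> \<le> 2 * B" for u using \<phi>_le[of u] \<phi>_nonneg[of u] by simp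
    qed
    then have "(\<lambda>n. \<Sum>i\<in>UNIV. \<integral>w. \<phi> (d n i w) \<partial>M) \<longlonglongrightarrow> (\<Sum>i\<in>(UNIV :: 'm set). \<phi> 0)"
      by (intro tendsto_sum)
    moreover have "\<phi> 0 = 0" using B0 by (simp add: \<phi>_def)
    ultimately show "(\<lambda>n. \<Sum>i\<in>(UNIV :: 'm set). \<integral>w. \<phi> (d n i w) \<partial>M) \<longlonglongrightarrow> 0" by simp
  qed
  moreover have "(\<lambda>n. \<integral>w. G z' n w \<partial>M) \<longlonglongrightarrow> (\<integral>w. f (\<chi> i. two_sided Zp Zm (x i) w) \<partial>N)"
    unfolding G_def z'_def by (rule medium_fixed_tendsto[OF c cont B])
  ultimately have "(\<lambda>n. ((\<integral>w. G z n w \<partial>M) - (\<integral>w. G z' n w \<partial>M)) + (\<integral>w. G z' n w \<partial>M))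
      \<longlonglongrightarrow> 0 + (\<integral>w. f (\<chi> i. two_sided Zp Zm (x i) w) \<partial>N)"
    by (rule tendsto_add)
  then show ?thesis by (simp add: G_def)
qed

end

section \<open>The medium at random positions\<close>

text \<open>Rounding away from 0, strictly: the grid point lies beyond \<open>x\<close> by at most
  \<open>1 / Suc k\<close>. Integer values reduce evaluation of a process at a random point to
  countably many cases.\<close>

definition grid_index :: "nat \<Rightarrow> real \<Rightarrow> int" where
  "grid_index k x = (if 0 \<le> x then \<lfloor>real (Suc k) * x\<rfloor> + 1 else - (\<lfloor>real (Suc k) * (- x)\<rfloor> + 1))"

lemma grid_index_measurable [measurable]: "grid_index k \<in> measurable borel (count_space UNIV)"
  unfolding grid_index_def[abs_def] by measurable

lemma measurable_int_sum:
  "(\<lambda>p. \<Sum>i=1..m. p i) \<in> measurable (PiM {1..} (\<lambda>_. count_space UNIV)) (count_space (UNIV :: int set))"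
proof -
  have "(\<lambda>p. \<Sum>i=1..m. real_of_int (p i)) \<in> borel_measurable (PiM {1..} (\<lambda>_. count_space UNIV))"
    by (rule borel_measurable_sum) (rule measurable_compose[OF measurable_component_singleton], auto)
  then have "(\<lambda>p. \<lfloor>\<Sum>i=1..m. real_of_int (p i)\<rfloor>) \<in> measurable (PiM {1..} (\<lambda>_. count_space UNIV)) (count_space UNIV)"
    by measurable
  then show ?thesis by (simp flip: of_int_sum)
qed

lemma (in prob_space) abs_expectation_le:
  fixes g :: "'a \<Rightarrow> real"
  assumes [measurable]: "g \<in> borel_measurable M" and B: "\<And>x. \<bar>g x\<bar> \<le> B"
  shows "\<bar>expectation g\<bar> \<le> B"
proof -
  have "0 \<le> B" using B[of undefined] by linarith
  have "\<bar>expectation g\<bar> \<le> expectation (\<lambda>x. \<bar>g x\<bar>)" by (rule integral_abs_bound)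
  also have "\<dots> \<le> expectation (\<lambda>_. B)"
    by (intro integral_mono integrable_const_bound[where B=B]) (auto simp: B \<open>0 \<le> B\<close>)
  finally show ?thesis by (simp add: prob_space)
qed

context medium_limit
begin

abbreviation Z :: "real \<Rightarrow> 'b \<Rightarrow> real" where "Z \<equiv> two_sided Zp Zm"

lemma Z_rv [measurable]: "Z x \<in> borel_measurable N"
  unfolding two_sided_def[abs_def] using levy_rv[OF levy(1), of x] levy_rv[OF levy(2), of "- x"]
  by (cases "0 \<le> x") auto

text \<open>On both half-lines the grid points approach \<open>x\<close> from the side away from \<open>0\<close>, where the paths are
  continuous; evaluating at grid points makes \<open>Z\<close> jointly measurable.\<close>

lemma Z_grid_tendsto:
  assumes w: "w \<in> space N"
  shows "(\<lambda>k. Z (real_of_int (grid_index k x) / real (Suc k)) w) \<longlonglongrightarrow> Z x w"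
proof (cases "0 \<le> x")
  case True
  let ?q = "\<lambda>k. (real_of_int \<lfloor>real (Suc k) * x\<rfloor> + 1) / real (Suc k)"
  have "(\<lambda>k. Zp (?q k) w) \<longlonglongrightarrow> Zp x w"
    by (rule filterlim_compose[OF levy_tendsto_at_right[OF levy(1) w True] filterlim_grid_at_right])
  moreover have "0 \<le> real_of_int \<lfloor>real (Suc k) * x\<rfloor>" for k using True by simp
  then have "0 \<le> ?q k" for k by (intro divide_nonneg_nonneg add_nonneg_nonneg) auto
  ultimately show ?thesis using True by (simp add: grid_index_def two_sided_def del: of_nat_Suc)
next
  case False
  let ?q = "\<lambda>k. (real_of_int \<lfloor>real (Suc k) * (- x)\<rfloor> + 1) / real (Suc k)"
  have x: "0 \<le> - x" "- x > 0" using False by auto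
  have "(\<lambda>k. Zm (?q k) w) \<longlonglongrightarrow> Zm (- x) w"
    by (rule filterlim_compose[OF levy_tendsto_at_right[OF levy(2) w x(1)] filterlim_grid_at_right])
  then have "(\<lambda>k. - Zm (?q k) w) \<longlonglongrightarrow> - Zm (- x) w" by (rule tendsto_minus)
  moreover have "Z (real_of_int (grid_index k x) / real (Suc k)) w = - Zm (?q k) w" for k
  proof -
    have eq: "real_of_int (grid_index k x) / real (Suc k) = - ?q k"
      using False by (simp add: grid_index_def del: of_nat_Suc minus_add_distrib flip: minus_divide_left)
    have "0 \<le> real_of_int \<lfloor>real (Suc k) * (- x)\<rfloor>"
      using x by (simp only: of_int_0_le_iff zero_le_floor mult_nonneg_nonneg of_nat_0_le_iff)
    then have "0 < ?q k" by (intro divide_pos_pos add_nonneg_pos) (assumption, simp_all)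
    then show ?thesis unfolding eq by (simp add: two_sided_def del: of_nat_Suc)
  qed
  ultimately show ?thesis using False by (simp add: two_sided_def)
qed

text \<open>Evaluation of a path at a random point is not measurable for the product
  \<sigma>-algebra over an uncountable index set, so Fubini cannot be applied to
  \<open>Z (W (t i) w) w\<close> directly. It is applied on the grid, where the evaluation is a
  countable case distinction, and right-continuity together with bounded convergence removes the
  grid on both sides.\<close>

lemma composition_integral:
  fixes t :: "'m::finite \<Rightarrow> real" and f :: "real ^ 'm \<Rightarrow> real"
  assumes W: "\<And>s. 0 \<le> s \<Longrightarrow> W s \<in> borel_measurable N"
    and ind: "indep_processes N borel {0..} W borel UNIV Z"
    and t: "\<And>i. 0 \<le> t i"
    and f: "continuous_on UNIV f" and B: "\<And>y. \<bar>f y\<bar> \<le> B"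
  defines "F \<equiv> \<lambda>x. \<integral>w. f (\<chi> i. Z (x i) w) \<partial>N"
  shows "(\<lambda>w. \<chi> i. Z (W (t i) w) w) \<in> borel_measurable N"
    and "F \<in> borel_measurable (PiM UNIV (\<lambda>_. borel))"
    and "(\<integral>w. f (\<chi> i. Z (W (t i) w) w) \<partial>N) = (\<integral>w. F (\<lambda>i. W (t i) w) \<partial>N)"
proof -
  let ?S = "PiM (UNIV :: 'm set) (\<lambda>_. borel :: real measure)"
  let ?T = "PiM {0 :: real..} (\<lambda>_. borel :: real measure)"
  have [measurable]: "f \<in> borel_measurable borel" using f by (rule borel_measurable_continuous_onI)
  have Wt [measurable]: "W (t i) \<in> borel_measurable N" for i by (rule W[OF t])
  define r where "r k x = real_of_int (grid_index k x) / real (Suc k)" for k x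
  have lim: "(\<lambda>k. f (\<chi> i. Z (r k (x i)) w)) \<longlonglongrightarrow> f (\<chi> i. Z (x i) w)" if "w \<in> space N" for x w
    using f unfolding r_def
    by (intro isCont_tendsto_compose[of _ f] tendsto_vec_lambda Z_grid_tendsto[OF that])
      (simp add: continuous_on_eq_continuous_at)
  have grid_rv: "(\<lambda>w. Y (r k (X w)) w) \<in> borel_measurable M'"
    if "X \<in> borel_measurable M'" and Y: "\<And>s. Y s \<in> borel_measurable M'"
    for X :: "'z \<Rightarrow> real" and Y :: "real \<Rightarrow> 'z \<Rightarrow> real" and M' k
    unfolding r_def
    by (rule measurable_compose_countable[where f="\<lambda>j w. Y (real_of_int j / real (Suc k)) w"])
      (use that in measurable)
  have vec_rv: "(\<lambda>w. f (\<chi> i. Y (r k (X i w)) w)) \<in> borel_measurable M'"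
    if "\<And>i. X i \<in> borel_measurable M'" "\<And>s. Y s \<in> borel_measurable M'"
    for X :: "'m \<Rightarrow> 'z \<Rightarrow> real" and Y :: "real \<Rightarrow> 'z \<Rightarrow> real" and M' k
  proof -
    have "(\<lambda>w. \<chi> i. Y (r k (X i w)) w) \<in> borel_measurable M'"
      by (rule borel_measurable_vec_lambdaI) (rule grid_rv[OF that])
    then show ?thesis by measurable
  qed
  define Fk where "Fk k x = (\<integral>w. f (\<chi> i. Z (r k (x i)) w) \<partial>N)" for k x
  have Fk [measurable]: "Fk k \<in> borel_measurable ?S" for k
    unfolding Fk_def[abs_def]
  proof (rule N.borel_measurable_lebesgue_integral)
    have "(\<lambda>xw. f (\<chi> i. Z (r k (fst xw i)) (snd xw))) \<in> borel_measurable (?S \<Otimes>\<^sub>M N)"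
      by (rule vec_rv[of "\<lambda>i xw. fst xw i" _ "\<lambda>s xw. Z s (snd xw)"]) measurable
    then show "(\<lambda>(x, w). f (\<chi> i. Z (r k (x i)) w)) \<in> borel_measurable (?S \<Otimes>\<^sub>M N)"
      by (simp add: case_prod_unfold)
  qed
  have Z_vec: "(\<lambda>w. f (\<chi> i. Z (x i) w)) \<in> borel_measurable N" for x
  proof -
    have "(\<lambda>w. \<chi> i. Z (x i) w) \<in> borel_measurable N"
      by (rule borel_measurable_vec_lambdaI) measurable
    then show ?thesis by measurable
  qed
  have FkF: "(\<lambda>k. Fk k x) \<longlonglongrightarrow> F x" for x
    unfolding Fk_def F_def
    by (rule integral_dominated_convergence[where w="\<lambda>_. B"])
      (auto simp: B lim Z_vec intro!: vec_rv)
  show F: "F \<in> borel_measurable ?S"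
    by (rule borel_measurable_LIMSEQ_real[OF FkF]) (rule Fk)
  show ZW: "(\<lambda>w. \<chi> i. Z (W (t i) w) w) \<in> borel_measurable N"
  proof (rule borel_measurable_vec_lambdaI)
    fix i
    show "(\<lambda>w. Z (W (t i) w) w) \<in> borel_measurable N"
    proof (rule borel_measurable_LIMSEQ_real)
      show "(\<lambda>k. Z (r k (W (t i) w)) w) \<longlonglongrightarrow> Z (W (t i) w) w" if "w \<in> space N" for w
        unfolding r_def by (rule Z_grid_tendsto[OF that])
      show "(\<lambda>w. Z (r k (W (t i) w)) w) \<in> borel_measurable N" for k
        by (rule grid_rv) measurable
    qed
  qed
  have eq: "(\<integral>w. f (\<chi> i. Z (r k (W (t i) w)) w) \<partial>N) = (\<integral>w. Fk k (\<lambda>i. W (t i) w) \<partial>N)" for k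
  proof -
    \<comment> \<open>The grid evaluation as a functional of the pair of sample paths; it reads the
      second path only at rational points.\<close>
    define g where "g pz = f (\<chi> i. snd pz (r k (fst pz (t i))))" for pz :: "(real \<Rightarrow> real) \<times> (real \<Rightarrow> real)"
    have comp: "(\<lambda>pz. fst pz (t i)) \<in> borel_measurable (?T \<Otimes>\<^sub>M PiM UNIV (\<lambda>_. borel))"
      "(\<lambda>pz. snd pz s) \<in> borel_measurable (?T \<Otimes>\<^sub>M PiM UNIV (\<lambda>_. borel))"
      for i :: 'm and s :: real
      using t[of i]
      by (auto intro!: measurable_compose[OF measurable_fst] measurable_compose[OF measurable_snd]
          measurable_component_singleton)
    have gB: "\<bar>g pz\<bar> \<le> B" for pz by (simp add: g_def B)
    have "g \<in> borel_measurable (?T \<Otimes>\<^sub>M PiM UNIV (\<lambda>_. borel))"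
      unfolding g_def[abs_def]
      by (rule vec_rv[of "\<lambda>i pz. fst pz (t i)" _ "\<lambda>s pz. snd pz s"]) (rule comp)+
    then have "(\<integral>w. g (sample_path {0..} W w, sample_path UNIV Z w) \<partial>N) =
        (\<integral>w. (\<integral>w'. g (sample_path {0..} W w, sample_path UNIV Z w') \<partial>N) \<partial>N)"
      by (intro indep_processes_integral[OF N.prob_space_axioms ind, where B=B] W gB Z_rv) auto
    then show ?thesis by (simp add: g_def Fk_def sample_path_def t)
  qed
  have "(\<lambda>k. \<integral>w. f (\<chi> i. Z (r k (W (t i) w)) w) \<partial>N) \<longlonglongrightarrow> (\<integral>w. f (\<chi> i. Z (W (t i) w) w) \<partial>N)"
  proof (rule integral_dominated_convergence[where w="\<lambda>_. B"])
    show "(\<lambda>w. f (\<chi> i. Z (W (t i) w) w)) \<in> borel_measurable N" using ZW by measurable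
    show "(\<lambda>w. f (\<chi> i. Z (r k (W (t i) w)) w)) \<in> borel_measurable N" for k
      by (rule vec_rv) measurable
  qed (auto simp: B lim)
  moreover have "(\<lambda>k. \<integral>w. Fk k (\<lambda>i. W (t i) w) \<partial>N) \<longlonglongrightarrow> (\<integral>w. F (\<lambda>i. W (t i) w) \<partial>N)"
  proof (rule integral_dominated_convergence[where w="\<lambda>_. B"])
    have Wv [measurable]: "(\<lambda>w i. W (t i) w) \<in> measurable N ?S"
      by (rule measurable_PiM_UNIV_I) measurable
    show "(\<lambda>w. F (\<lambda>i. W (t i) w)) \<in> borel_measurable N" by (rule measurable_compose[OF Wv F])
    show "(\<lambda>w. Fk k (\<lambda>i. W (t i) w)) \<in> borel_measurable N" for k by (rule measurable_compose[OF Wv Fk])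
    have "norm (Fk k x) \<le> B" for k x
      unfolding Fk_def real_norm_def by (rule N.abs_expectation_le) (rule vec_rv, auto simp: B)
    then show "AE w in N. norm (Fk k (\<lambda>i. W (t i) w)) \<le> B" for k by simp
  qed (auto simp: FkF)
  ultimately show "(\<integral>w. f (\<chi> i. Z (W (t i) w) w) \<partial>N) = (\<integral>w. F (\<lambda>i. W (t i) w) \<partial>N)"
    unfolding eq by (rule LIMSEQ_unique)
qed

text \<open>\<open>G n\<close> averages the discrete medium and \<open>F\<close> the limit medium,
  each at frozen positions. Continuous convergence of \<open>G n\<close> to \<open>F\<close> is
  evaluated along the pointwise convergent copies of the walk, and equality of laws then returns to
  the original walk and to \<open>W\<close>.\<close>

lemma walk_on_medium_integral_tendsto:
  fixes \<xi> :: "nat \<Rightarrow> 'a \<Rightarrow> int" and t :: "'m::finite \<Rightarrow> real" and f :: "real ^ 'm \<Rightarrow> real"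
  assumes \<xi>: "attracted_sums M (\<lambda>i w. real_of_int (\<xi> i w)) \<alpha> Q"
    and \<xi>_rv: "\<And>i. i \<in> {1..} \<Longrightarrow> \<xi> i \<in> measurable M (count_space UNIV)"
    and \<xi>_indep: "indep_processes M borel UNIV \<zeta> (count_space UNIV) {1..} \<xi>"
    and W: "levy_process N W" "distr N borel (W 1) = Q"
    and W_indep: "indep_processes N borel {0..} W borel UNIV Z"
    and t: "\<And>i. 0 \<le> t i"
    and f: "K-lipschitz_on UNIV f" and B: "\<And>y. \<bar>f y\<bar> \<le> B"
  shows "(\<lambda>n. \<integral>w. f (\<chi> i. rescaled_walk \<alpha> \<beta> \<zeta> \<xi> n (t i) w) \<partial>M) \<longlonglongrightarrow> (\<integral>w. f (\<chi> i. Z (W (t i) w) w) \<partial>N)"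
proof -
  interpret \<xi>: attracted_sums M "\<lambda>i w. real_of_int (\<xi> i w)" \<alpha> Q by fact
  let ?S = "PiM (UNIV :: 'm set) (\<lambda>_. borel :: real measure)"
  have cont: "continuous_on UNIV f" using f by (rule lipschitz_on_continuous_on)
  have [measurable]: "f \<in> borel_measurable borel" using cont by (rule borel_measurable_continuous_onI)
  define c where "c n = real n powr (1 / \<alpha>)" for n
  have c: "filterlim c at_top sequentially" "\<And>n. 0 \<le> c n"
  proof -
    have "LIM n sequentially. inverse (real n powr (- (1 / \<alpha>))) :> at_top"
    proof (rule filterlim_inverse_at_top)
      show "(\<lambda>n. real n powr (- (1 / \<alpha>))) \<longlonglongrightarrow> 0"
        by (rule tendsto_neg_powr[OF _ filterlim_real_sequentially]) (simp add: \<xi>.index_pos)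
      show "\<forall>\<^sub>F n in sequentially. 0 < real n powr (- (1 / \<alpha>))"
        by (rule eventually_mono[OF eventually_gt_at_top[of 0]]) simp
    qed
    then show "filterlim c at_top sequentially" by (simp add: c_def[abs_def] powr_minus)
  qed (simp add: c_def)
  have c_\<beta>: "c n powr (1 / \<beta>) = real n powr (1 / (\<alpha> * \<beta>))" for n
    by (simp add: c_def powr_powr)
  define V where "V n w i = (\<Sum>j=1..nat \<lfloor>real n * t i\<rfloor>. real_of_int (\<xi> j w)) / c n" for n w i
  obtain \<Omega> Y Y_lim where "coupled_sums M (\<lambda>i w. real_of_int (\<xi> i w)) \<alpha> Q \<Omega> Y Y_lim"
    using \<xi>.coupled_sums_exists .
  then obtain \<Omega>' :: "(nat \<Rightarrow> real) measure" and U U' where U: "prob_space \<Omega>'"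
    "\<And>n. U n \<in> measurable \<Omega>' ?S" "U' \<in> measurable \<Omega>' ?S"
    "\<And>n. distr M ?S (V n) = distr \<Omega>' ?S (U n)" "distr N ?S (\<lambda>w i. W (t i) w) = distr \<Omega>' ?S U'"
    "\<And>\<omega> i. \<omega> \<in> space \<Omega>' \<Longrightarrow> (\<lambda>n. U n \<omega> i) \<longlonglongrightarrow> U' \<omega> i"
    unfolding V_def[abs_def] c_def
    by (rule coupled_sums.fdd_coupling[where s=t, OF _ filterlim_real_sequentially of_nat_0_le_iff t N.prob_space_axioms W]) blast
  interpret \<Omega>': prob_space \<Omega>' by fact
  have V_rv [measurable]: "V n \<in> measurable M ?S" for n
    unfolding V_def[abs_def] by (intro measurable_PiM_UNIV_I borel_measurable_divide \<xi>.rv_sum) auto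
  have W_rv [measurable]: "(\<lambda>w i. W (t i) w) \<in> measurable N ?S"
    by (rule measurable_PiM_UNIV_I) (rule levy_rv[OF W(1) t])
  define F where "F x = (\<integral>w. f (\<chi> i. Z (x i) w) \<partial>N)" for x
  have W_meas: "W s \<in> borel_measurable N" if "0 \<le> s" for s by (rule levy_rv[OF W(1) that])
  have F_rv: "F \<in> borel_measurable ?S"
    unfolding F_def[abs_def]
    by (rule composition_integral(2)[where W=W and t=t and B=B]) (rule W_meas W_indep t cont B, assumption?)+
  have F_comp: "(\<integral>w. f (\<chi> i. Z (W (t i) w) w) \<partial>N) = (\<integral>w. F (\<lambda>i. W (t i) w) \<partial>N)"
    unfolding F_def
    by (rule composition_integral(3)[where W=W and t=t and B=B]) (rule W_meas W_indep t cont B, assumption?)+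
  \<comment> \<open>The floor makes \<open>G n\<close> meaningful at every real vector. This matters
    for the copies \<open>U n\<close>, which share the law of the rescaled walk but need not take
    lattice values at every sample point.\<close>
  define G where "G n x = (\<integral>w. f (\<chi> i. medium \<zeta> \<lfloor>c n * x i\<rfloor> w / c n powr (1 / \<beta>)) \<partial>M)" for n x
  have vec_rv: "(\<lambda>w. f (\<chi> i. Y (X i w) w / a)) \<in> borel_measurable M'"
    if "\<And>i. X i \<in> measurable M' (count_space UNIV)" "\<And>s. Y s \<in> borel_measurable M'"
    for X :: "'m \<Rightarrow> 'z \<Rightarrow> int" and Y :: "int \<Rightarrow> 'z \<Rightarrow> real" and a and M'
  proof -
    have "(\<lambda>w. \<chi> i. Y (X i w) w / a) \<in> borel_measurable M'"
      by (intro borel_measurable_vec_lambdaI borel_measurable_divide borel_measurable_const)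
        (rule measurable_compose_countable[where f=Y], rule that, rule that)
    then show ?thesis by measurable
  qed
  have G_rv [measurable]: "G n \<in> borel_measurable ?S" for n
    unfolding G_def[abs_def]
  proof (rule borel_measurable_lebesgue_integral)
    have "(\<lambda>xw. f (\<chi> i. medium \<zeta> \<lfloor>c n * fst xw i\<rfloor> (snd xw) / c n powr (1 / \<beta>))) \<in> borel_measurable (?S \<Otimes>\<^sub>M M)"
      by (rule vec_rv[of "\<lambda>i xw. \<lfloor>c n * fst xw i\<rfloor>" _ "\<lambda>s xw. medium \<zeta> s (snd xw)"]) measurable
    then show "(\<lambda>(x, w). f (\<chi> i. medium \<zeta> \<lfloor>c n * x i\<rfloor> w / c n powr (1 / \<beta>))) \<in> borel_measurable (?S \<Otimes>\<^sub>M M)"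
      by (simp add: case_prod_unfold)
  qed
  have walk_given: "(\<integral>w. f (\<chi> i. rescaled_walk \<alpha> \<beta> \<zeta> \<xi> n (t i) w) \<partial>M) = (\<integral>w. G n (V n w) \<partial>M)" if "0 < n" for n
  proof -
    let ?m = "\<lambda>i. nat \<lfloor>real n * t i\<rfloor>"
    let ?P = "PiM {1 :: nat..} (\<lambda>_. count_space (UNIV :: int set)) \<Otimes>\<^sub>M PiM (UNIV :: int set) (\<lambda>_. borel :: real measure)"
    \<comment> \<open>Applied to the coordinate family, \<open>medium\<close> becomes a functional
      of one environment path, as the freezing of the walk requires.\<close>
    define g where "g pz = f (\<chi> i. medium (\<lambda>k z. z k) (\<Sum>j=1..?m i. fst pz j) (snd pz) / c n powr (1 / \<beta>))"
      for pz :: "(nat \<Rightarrow> int) \<times> (int \<Rightarrow> real)"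
    have med: "(\<lambda>pz. medium (\<lambda>k z. z k) s (snd pz)) \<in> borel_measurable ?P" for s
      unfolding medium_def by measurable
    have gB: "\<bar>g pz\<bar> \<le> B" for pz by (simp add: g_def B)
    have "g \<in> borel_measurable ?P"
      unfolding g_def[abs_def]
      by (rule vec_rv[of "\<lambda>i pz. \<Sum>j=1..?m i. fst pz j" _ "\<lambda>s pz. medium (\<lambda>k z. z k) s (snd pz)"])
        (rule measurable_compose[OF measurable_fst measurable_int_sum] med)+
    then have "(\<integral>w. g (sample_path {1..} \<xi> w, sample_path UNIV \<zeta> w) \<partial>M) =
        (\<integral>w. (\<integral>w'. g (sample_path {1..} \<xi> w, sample_path UNIV \<zeta> w') \<partial>M) \<partial>M)"
      by (intro indep_processes_integral[OF prob_space_axioms indep_processes_commute[OF prob_space_axioms \<xi>_indep],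
            where B=B] \<xi>_rv rv gB)
    moreover have "g (sample_path {1..} \<xi> w, sample_path UNIV \<zeta> w') =
        f (\<chi> i. medium \<zeta> (walk \<xi> (?m i) w) w' / c n powr (1 / \<beta>))" for w w'
      by (simp add: g_def sample_path_def walk_def medium_def restrict_UNIV)
    \<comment> \<open>For positive \<open>n\<close> the factor \<open>c n\<close> cancels and leaves
      an integer, so on the walk itself the floor changes nothing.\<close>
    moreover have "\<lfloor>c n * V n w i\<rfloor> = walk \<xi> (?m i) w" for w i
      using that by (simp add: V_def c_def walk_def flip: of_int_sum)
    ultimately show ?thesis
      by (simp add: G_def rescaled_walk_def walk_on_medium_def c_\<beta>)
  qed
  have lim: "(\<lambda>n. G n (U n \<omega>)) \<longlonglongrightarrow> F (U' \<omega>)" if "\<omega> \<in> space \<Omega>'" for \<omega>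
    unfolding G_def F_def by (rule medium_moving_tendsto[OF c floor_ratio_tendsto[OF c(1) U(6)[OF that]] f B])
  have "(\<lambda>n. \<integral>\<omega>. G n (U n \<omega>) \<partial>\<Omega>') \<longlonglongrightarrow> (\<integral>\<omega>. F (U' \<omega>) \<partial>\<Omega>')"
  proof (rule integral_dominated_convergence[where w="\<lambda>_. B"])
    show "(\<lambda>\<omega>. F (U' \<omega>)) \<in> borel_measurable \<Omega>'" by (rule measurable_compose[OF U(3) F_rv])
    show "(\<lambda>\<omega>. G n (U n \<omega>)) \<in> borel_measurable \<Omega>'" for n by (rule measurable_compose[OF U(2) G_rv])
    have "\<bar>G n x\<bar> \<le> B" for n x
      unfolding G_def by (rule abs_expectation_le, rule vec_rv) (auto simp: B)
    then show "AE \<omega> in \<Omega>'. norm (G n (U n \<omega>)) \<le> B" for n by simp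
  qed (auto simp: lim)
  moreover have "(\<integral>\<omega>. G n (U n \<omega>) \<partial>\<Omega>') = (\<integral>w. G n (V n w) \<partial>M)" for n
    by (rule integral_cong_distr[OF V_rv U(2) U(4) G_rv, symmetric])
  moreover have "(\<integral>\<omega>. F (U' \<omega>) \<partial>\<Omega>') = (\<integral>w. f (\<chi> i. Z (W (t i) w) w) \<partial>N)"
    unfolding F_comp by (rule integral_cong_distr[OF W_rv U(3) U(5) F_rv, symmetric])
  ultimately have "(\<lambda>n. \<integral>w. G n (V n w) \<partial>M) \<longlonglongrightarrow> (\<integral>w. f (\<chi> i. Z (W (t i) w) w) \<partial>N)" by simp
  then show ?thesis
    by (rule Lim_transform_eventually)
      (use walk_given in \<open>auto intro!: eventually_mono[OF eventually_gt_at_top[of 0]]\<close>)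
qed

end

section \<open>Stable laws as instances of the abstract setting, and the limit theorem\<close>

lemma stable_law_char_nonzero: "stable_law \<alpha> b P \<Longrightarrow> char P \<theta> \<noteq> 0"
  by (auto simp: stable_law_def stable_char_def Let_def)

lemma stable_lawD: "stable_law \<alpha> b P \<Longrightarrow> 0 < \<alpha> \<and> real_distribution P"
  by (simp add: stable_law_def)

lemma attracted_sums_of_int:
  assumes M: "prob_space M" and \<xi>: "iid M (count_space UNIV) {1..} \<xi>"
    and P: "stable_law \<alpha> b P" and attr: "normally_attracted M (\<lambda>i w. real_of_int (\<xi> i w)) \<alpha> P"
  shows "attracted_sums M (\<lambda>i w. real_of_int (\<xi> i w)) \<alpha> P"
proof (intro attracted_sums.intro attracted_sums_axioms.intro)
  interpret prob_space M by fact
  have ind: "indep_vars (\<lambda>_. count_space UNIV) \<xi> {1..}" using \<xi> unfolding iid_def by blast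
  then have rv: "\<xi> i \<in> measurable M (count_space UNIV)" if "i \<in> {1..}" for i
    using that unfolding indep_vars_def by blast
  have "distr M borel (\<lambda>w. real_of_int (\<xi> i w)) = distr M borel (\<lambda>w. real_of_int (\<xi> j w))"
    if "i \<in> {1..}" "j \<in> {1..}" for i j
  proof (rule distr_compose_cong[OF rv rv])
    show "distr M (count_space UNIV) (\<xi> i) = distr M (count_space UNIV) (\<xi> j)"
      using \<xi> that unfolding iid_def by blast
  qed (use that in simp_all)
  moreover have "indep_vars (\<lambda>_. borel) (\<lambda>i w. real_of_int (\<xi> i w)) {1..}"
    by (rule indep_vars_compose2[OF ind]) simp
  ultimately show "iid M borel {1..} (\<lambda>i w. real_of_int (\<xi> i w))" unfolding iid_def by blast
  show "0 < \<alpha>" "real_distribution P" using stable_lawD[OF P] by blast+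
qed (rule M attr stable_law_char_nonzero[OF P])+


theorem theorem2p1:
  fixes M :: "'a measure" and N :: "'b measure"
    and \<zeta> :: "int \<Rightarrow> 'a \<Rightarrow> real" and \<xi> :: "nat \<Rightarrow> 'a \<Rightarrow> int"
    and \<alpha> \<beta> b :: real and Zlaw Wlaw :: "real measure"
    and Zp Zm W :: "real \<Rightarrow> 'b \<Rightarrow> real"
    and t :: "real ^ 'm"
  assumes "prob_space M"
    and "0 < \<beta>" "\<beta> < 1"
    and "(0 < \<alpha> \<and> \<alpha> < 1) \<or>
         (1 < \<alpha> \<and> \<alpha> < 2 \<and> integrable M (\<lambda>w. real_of_int (\<xi> 1 w)) \<and>
          (\<integral>w. real_of_int (\<xi> 1 w) \<partial>M) = 0)"
    and "iid M borel UNIV \<zeta>"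
    and "\<forall>i. AE w in M. 0 < \<zeta> i w"
    and "stable_law \<beta> 1 Zlaw"
    and "normally_attracted M (\<lambda>i. \<zeta> (int i)) \<beta> Zlaw"
    and "iid M (count_space UNIV) {1..} \<xi>"
    and "stable_law \<alpha> b Wlaw"
    and "normally_attracted M (\<lambda>i w. real_of_int (\<xi> i w)) \<alpha> Wlaw"
    and "indep_processes M borel UNIV \<zeta> (count_space UNIV) {1..} \<xi>"
    and "prob_space N"
    and "levy_process N Zp" "distr N borel (Zp 1) = Zlaw"
    and "levy_process N Zm" "distr N borel (Zm 1) = Zlaw"
    and "indep_processes N borel {0..} Zp borel {0..} Zm"
    and "distr N (\<Pi>\<^sub>M s\<in>{0..}. borel) (sample_path {0..} Zp) =
         distr N (\<Pi>\<^sub>M s\<in>{0..}. borel) (sample_path {0..} Zm)"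
    and "levy_process N W" "distr N borel (W 1) = Wlaw"
    and "indep_processes N borel {0..} W borel UNIV (two_sided Zp Zm)"
    and "\<forall>j. 0 \<le> t $ j"
  shows "converges_in_distr
           M (\<lambda>n w. \<chi> j. rescaled_walk \<alpha> \<beta> \<zeta> \<xi> n (t $ j) w)
           N (\<lambda>w. \<chi> j. two_sided Zp Zm (W (t $ j) w) w)"
proof -
  have iid_\<xi>: "iid M (count_space UNIV) {1..} \<xi>" and W: "levy_process N W" "distr N borel (W 1) = Wlaw"
    and W_indep: "indep_processes N borel {0..} W borel UNIV (two_sided Zp Zm)"
    and t: "\<And>j. 0 \<le> t $ j"
    using assms by blast+
  have \<xi>_rv: "\<xi> i \<in> measurable M (count_space UNIV)" if "i \<in> {1..}" for i
    using iid_\<xi> that unfolding iid_def prob_space.indep_vars_def[OF \<open>prob_space M\<close>] by blast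
  have sums: "attracted_sums M (\<lambda>i w. real_of_int (\<xi> i w)) \<alpha> Wlaw"
    by (rule attracted_sums_of_int) fact+
  interpret medium_limit M \<zeta> \<beta> Zlaw N Zp Zm
    using stable_lawD[OF \<open>stable_law \<beta> 1 Zlaw\<close>]
    by (intro medium_limit.intro medium_limit_axioms.intro random_medium.intro random_medium_axioms.intro
        stable_law_char_nonzero[OF \<open>stable_law \<beta> 1 Zlaw\<close>] assms) blast+
  have walk_rv: "walk \<xi> m \<in> measurable M (count_space UNIV)" for m
    using measurable_compose[OF sample_path_measurable[where X=\<xi>, OF \<xi>_rv] measurable_int_sum[of m]]
    by (simp add: sample_path_def walk_def[abs_def])
  show ?thesis
  proof (rule converges_in_distr_lipschitzI[OF \<open>prob_space M\<close> \<open>prob_space N\<close>])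
    show "(\<lambda>w. \<chi> j. rescaled_walk \<alpha> \<beta> \<zeta> \<xi> n (t $ j) w) \<in> borel_measurable M" for n
      unfolding rescaled_walk_def walk_on_medium_def
      by (intro borel_measurable_vec_lambdaI borel_measurable_divide borel_measurable_const)
        (rule measurable_compose_countable[OF rv_medium walk_rv])
    show "(\<lambda>w. \<chi> j. two_sided Zp Zm (W (t $ j) w) w) \<in> borel_measurable N"
      \<comment> \<open>Measurability of the composition does not involve the test function, so the
        zero function is supplied.\<close>
      by (rule composition_integral(1)[where f="\<lambda>_. 0" and B=0])
        (auto intro: levy_rv[OF W(1)] W_indep t)
    show "(\<lambda>n. \<integral>w. f (\<chi> j. rescaled_walk \<alpha> \<beta> \<zeta> \<xi> n (t $ j) w) \<partial>M)
        \<longlonglongrightarrow> (\<integral>w. f (\<chi> j. two_sided Zp Zm (W (t $ j) w) w) \<partial>N)"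
      if f: "L-lipschitz_on UNIV f" and B: "\<And>x. \<bar>f x\<bar> \<le> B" for f :: "real ^ 'm \<Rightarrow> real" and L B
      by (rule walk_on_medium_integral_tendsto[OF sums _ _ W W_indep t f B]) (erule \<xi>_rv, fact)
  qed
qed

end
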